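(* Let $M$ be a real hypersurface in a non-flat complex space form $\tilde M^n(4c)$, $c\neq 0$. Then, for any point $p\in M$ and any unit vector $X\in T_pM$, we have $$Ric(X)\leq \frac{(2n-1)^2}{8}\|H\|^2+\kappa_X^2+c\,(2n-2+3\|\phi X\|^2).$$ The equality sign holds at $p\in M$ if and only if there exists an orthonormal basis $\{e_1,e_2,\ldots,e_{2n-1}\}$ of $T_pM$ such that $e_{2n-1}=X$ and the shape operator $A$ of $M$ in $\tilde M^n(4c)$ at $p$ is represented with respect to this basis by a matrix $$A=\begin{pmatrix} B & 0\\ 0 & \mu\end{pmatrix},$$ where $B$ is a symmetric $(2n-2)\times(2n-2)$ matrix, $\mu\in\mathbb{R}$ (the off-diagonal blocks are a zero column and a zero row of length $2n-2$), and $\mathrm{Tr}(B)=3\mu$.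
   Context: $\tilde M^n(4c)$ denotes an $n$-dimensional complex space form of constant holomorphic sectional curvature $4c\neq 0$, i.e. complex projective space $\mathbb{C}P^n(4c)$ if $c>0$ or complex hyperbolic space $\mathbb{C}H^n(4c)$ if $c<0$; $n$ is the complex dimension. $J$ is its almost complex structure and $\tilde\nabla$ its Levi-Civita connection. For a real hypersurface $M$ (real dimension $2n-1$, induced metric $\langle\cdot,\cdot\rangle$) with unit normal vector field $N$, the shape operator is $AX=-\tilde\nabla_XN$. The mean curvature vector field is $H=\frac{\mathrm{Tr}(A)}{2n-1}N$. For a tangent vector $X$, $\phi X$ denotes the tangential component of $JX$. For a unit vector $X\in T_pM$, the normal curvature is $\kappa_X=\langle AX,X\rangle$, and $Ric(X)$ is the Ricci curvature of $M$ in the direction $X$, i.e. $Ric(X)=\sum_{j}\langle R(e_j,X)X,e_j\rangle$ for an orthonormal basis $\{e_j\}$ of $T_pM$, with $R$ the Riemannian curvature tensor of $M$ (sign convention such that round spheres have positive Ricci curvature). *)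

theory Defs
  imports "HOL-Analysis.Analysis"
begin

section \<open>Smooth and complex manifolds\<close>

primrec Ck_on :: "nat \<Rightarrow> ('a::real_normed_vector \<Rightarrow> 'b::real_normed_vector) \<Rightarrow> 'a set \<Rightarrow> bool" where
  "Ck_on 0 f S \<longleftrightarrow> continuous_on S f"
| "Ck_on (Suc k) f S \<longleftrightarrow>
     (\<forall>x\<in>S. f differentiable (at x)) \<and> (\<forall>v. Ck_on k (\<lambda>x. frechet_derivative f (at x) v) S)"

text \<open>Only used for open sets \<open>S\<close>.\<close>

definition smooth_on :: "('a::real_normed_vector \<Rightarrow> 'b::real_normed_vector) \<Rightarrow> 'a set \<Rightarrow> bool" where
  "smooth_on f S \<longleftrightarrow> (\<forall>k. Ck_on k f S)"

text \<open>A chart is a pair of its domain and its coordinate map. A manifold is a type (all of its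
  points) together with an atlas; the atlas need not be maximal.\<close>

type_synonym ('m, 'e) chart = "'m set \<times> ('m \<Rightarrow> 'e)"

definition chart_inv :: "('m, 'e) chart \<Rightarrow> 'e \<Rightarrow> 'm" where
  "chart_inv \<phi> = inv_into (fst \<phi>) (snd \<phi>)"

definition in_charts :: "('m, 'e) chart \<Rightarrow> ('a, 'b) chart \<Rightarrow> ('m \<Rightarrow> 'a) \<Rightarrow> 'e \<Rightarrow> 'b" where
  "in_charts \<phi> \<psi> f = snd \<psi> \<circ> f \<circ> chart_inv \<phi>"

definition smooth_atlas :: "('m::topological_space, 'e::euclidean_space) chart set \<Rightarrow> bool" where
  "smooth_atlas \<A> \<longleftrightarrow>
     (\<forall>\<phi>\<in>\<A>. open (fst \<phi>) \<and> open (snd \<phi> ` fst \<phi>) \<and>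
        homeomorphism (fst \<phi>) (snd \<phi> ` fst \<phi>) (snd \<phi>) (chart_inv \<phi>)) \<and>
     (\<Union>\<phi>\<in>\<A>. fst \<phi>) = UNIV \<and>
     (\<forall>\<phi>\<in>\<A>. \<forall>\<psi>\<in>\<A>. smooth_on (in_charts \<phi> \<psi> (\<lambda>q. q)) (snd \<phi> ` (fst \<phi> \<inter> fst \<psi>)))"

text \<open>Multiplication by the imaginary unit. In holomorphic charts it is the coordinate expression
  of the almost complex structure of a complex manifold, with constant coefficients.\<close>

definition Jc :: "complex ^ 'n \<Rightarrow> complex ^ 'n" where
  "Jc v = \<i> *s v"

text \<open>The transition maps are holomorphic: their real derivatives are complex linear.\<close>

definition complex_atlas :: "('a::topological_space, complex ^ 'n) chart set \<Rightarrow> bool" where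
  "complex_atlas \<A> \<longleftrightarrow> smooth_atlas \<A> \<and>
     (\<forall>\<phi>\<in>\<A>. \<forall>\<psi>\<in>\<A>. \<forall>x\<in>snd \<phi> ` (fst \<phi> \<inter> fst \<psi>). \<forall>v.
        frechet_derivative (in_charts \<phi> \<psi> (\<lambda>q. q)) (at x) (Jc v) =
        Jc (frechet_derivative (in_charts \<phi> \<psi> (\<lambda>q. q)) (at x) v))"

section \<open>Riemannian metrics\<close>

text \<open>Tangent vectors are represented by their components in a chart. A metric on a coordinate
  domain assigns to every coordinate point \<open>x\<close> an inner product \<open>G x\<close>; a metric on a manifold
  assigns such a coordinate metric \<open>g \<phi>\<close> to every chart \<open>\<phi>\<close>, subject to the usual
  transformation law.\<close>

type_synonym 'e metric = "'e \<Rightarrow> 'e \<Rightarrow> 'e \<Rightarrow> real"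

definition inner_product :: "('e::euclidean_space \<Rightarrow> 'e \<Rightarrow> real) \<Rightarrow> bool" where
  "inner_product b \<longleftrightarrow> bilinear b \<and> (\<forall>u v. b u v = b v u) \<and> (\<forall>u. u \<noteq> 0 \<longrightarrow> b u u > 0)"

definition riemannian_manifold ::
  "('m::topological_space, 'e::euclidean_space) chart set \<Rightarrow> (('m, 'e) chart \<Rightarrow> 'e metric) \<Rightarrow> bool"
where
  "riemannian_manifold \<A> g \<longleftrightarrow> smooth_atlas \<A> \<and>
     (\<forall>\<phi>\<in>\<A>. (\<forall>x\<in>snd \<phi> ` fst \<phi>. inner_product (g \<phi> x)) \<and>
        (\<forall>u v. smooth_on (\<lambda>x. g \<phi> x u v) (snd \<phi> ` fst \<phi>))) \<and>
     (\<forall>\<phi>\<in>\<A>. \<forall>\<psi>\<in>\<A>. \<forall>q\<in>fst \<phi> \<inter> fst \<psi>. \<forall>u v.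
        g \<phi> (snd \<phi> q) u v =
        g \<psi> (snd \<psi> q)
          (frechet_derivative (in_charts \<phi> \<psi> (\<lambda>q. q)) (at (snd \<phi> q)) u)
          (frechet_derivative (in_charts \<phi> \<psi> (\<lambda>q. q)) (at (snd \<phi> q)) v))"

text \<open>Christoffel symbols of the Levi-Civita connection, \<open>christoffel G x u v\<close> being the value at
  \<open>x\<close> of \<open>\<nabla>\<^sub>u v\<close> for constant coordinate fields \<open>u\<close>, \<open>v\<close>, given by the Koszul formula.\<close>

definition christoffel :: "'e::euclidean_space metric \<Rightarrow> 'e \<Rightarrow> 'e \<Rightarrow> 'e \<Rightarrow> 'e" where
  "christoffel G x u v = (THE z. \<forall>w. G x z w =
     (frechet_derivative (\<lambda>y. G y v w) (at x) u
      + frechet_derivative (\<lambda>y. G y u w) (at x) v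
      - frechet_derivative (\<lambda>y. G y u v) (at x) w) / 2)"

definition cov_deriv ::
  "'e::euclidean_space metric \<Rightarrow> ('e \<Rightarrow> 'e) \<Rightarrow> 'e \<Rightarrow> 'e \<Rightarrow> 'e" where
  "cov_deriv G Y x u = frechet_derivative Y (at x) u + christoffel G x u (Y x)"

text \<open>\<open>R(u,v)w = \<nabla>\<^sub>u \<nabla>\<^sub>v w - \<nabla>\<^sub>v \<nabla>\<^sub>u w - \<nabla>\<^bsub>[u,v]\<^esub> w\<close>, evaluated on constant coordinate fields, for
  which the bracket vanishes.\<close>

definition curvature :: "'e::euclidean_space metric \<Rightarrow> 'e \<Rightarrow> 'e \<Rightarrow> 'e \<Rightarrow> 'e \<Rightarrow> 'e" where
  "curvature G x u v w =
     cov_deriv G (\<lambda>y. cov_deriv G (\<lambda>_. w) y v) x u -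
     cov_deriv G (\<lambda>y. cov_deriv G (\<lambda>_. w) y u) x v"

definition sectional_curvature :: "'e::euclidean_space metric \<Rightarrow> 'e \<Rightarrow> 'e \<Rightarrow> 'e \<Rightarrow> real" where
  "sectional_curvature G x u v =
     G x (curvature G x u v v) u / (G x u u * G x v v - (G x u v)\<^sup>2)"

definition orthonormal_basis ::
  "('e::euclidean_space \<Rightarrow> 'e \<Rightarrow> real) \<Rightarrow> (nat \<Rightarrow> 'e) \<Rightarrow> bool" where
  "orthonormal_basis b e \<longleftrightarrow>
     (\<forall>i\<in>{1..DIM('e)}. \<forall>j\<in>{1..DIM('e)}. b (e i) (e j) = (if i = j then 1 else 0))"

text \<open>The sum does not depend on the orthonormal basis chosen.\<close>

definition Ric :: "'e::euclidean_space metric \<Rightarrow> 'e \<Rightarrow> 'e \<Rightarrow> real" where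
  "Ric G x u =
     (let e = (SOME e. orthonormal_basis (G x) e)
      in \<Sum>j=1..DIM('e). G x (curvature G x (e j) u u) (e j))"

text \<open>The geodesic equation \<open>\<nabla>\<^bsub>\<gamma>'\<^esub> \<gamma>' = 0\<close>, for curves defined on the whole real line.\<close>

definition geodesic ::
  "('m::topological_space, 'e::euclidean_space) chart set \<Rightarrow> (('m, 'e) chart \<Rightarrow> 'e metric) \<Rightarrow>
   (real \<Rightarrow> 'm) \<Rightarrow> bool" where
  "geodesic \<A> g \<gamma> \<longleftrightarrow> continuous_on UNIV \<gamma> \<and>
     (\<forall>\<phi>\<in>\<A>. \<exists>V. \<forall>t. \<gamma> t \<in> fst \<phi> \<longrightarrow>
        ((\<lambda>s. snd \<phi> (\<gamma> s)) has_vector_derivative V t) (at t) \<and>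
        (V has_vector_derivative - christoffel (g \<phi>) (snd \<phi> (\<gamma> t)) (V t) (V t)) (at t))"

definition complete_manifold ::
  "('m::topological_space, 'e::euclidean_space) chart set \<Rightarrow> (('m, 'e) chart \<Rightarrow> 'e metric) \<Rightarrow> bool"
where
  "complete_manifold \<A> g \<longleftrightarrow>
     (\<forall>\<phi>\<in>\<A>. \<forall>q\<in>fst \<phi>. \<forall>v. \<exists>\<gamma>. geodesic \<A> g \<gamma> \<and> \<gamma> 0 = q \<and>
        ((\<lambda>s. snd \<phi> (\<gamma> s)) has_vector_derivative v) (at 0))"

section \<open>Complex space forms\<close>

text \<open>A Kaehler manifold is a complex manifold with a Hermitian metric for which \<open>\<nabla>J = 0\<close>.\<close>

definition kaehler_manifold ::
  "('a::topological_space, complex ^ 'n) chart set \<Rightarrow>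
   (('a, complex ^ 'n) chart \<Rightarrow> (complex ^ 'n) metric) \<Rightarrow> bool" where
  "kaehler_manifold \<A> g \<longleftrightarrow> complex_atlas \<A> \<and> riemannian_manifold \<A> g \<and>
     (\<forall>\<phi>\<in>\<A>. \<forall>x\<in>snd \<phi> ` fst \<phi>. \<forall>u v.
        g \<phi> x (Jc u) (Jc v) = g \<phi> x u v \<and>
        cov_deriv (g \<phi>) (\<lambda>_. Jc v) x u = Jc (cov_deriv (g \<phi>) (\<lambda>_. v) x u))"

text \<open>A complex space form of constant holomorphic sectional curvature \<open>k\<close>: a complete, simply
  connected Kaehler manifold all of whose holomorphic planes, spanned by some \<open>u\<close> and \<open>J u\<close>, have
  sectional curvature \<open>k\<close>. Up to holomorphic isometry these are, in complex dimension \<open>n\<close>, exactly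
  the complex projective space (\<open>k > 0\<close>), the complex hyperbolic space (\<open>k < 0\<close>) and the flat
  space (\<open>k = 0\<close>).\<close>

definition complex_space_form ::
  "('a::topological_space, complex ^ 'n) chart set \<Rightarrow>
   (('a, complex ^ 'n) chart \<Rightarrow> (complex ^ 'n) metric) \<Rightarrow> real \<Rightarrow> bool" where
  "complex_space_form \<A> g k \<longleftrightarrow>
     kaehler_manifold \<A> g \<and> complete_manifold \<A> g \<and> simply_connected (UNIV :: 'a set) \<and>
     (\<forall>\<phi>\<in>\<A>. \<forall>x\<in>snd \<phi> ` fst \<phi>. \<forall>u. u \<noteq> 0 \<longrightarrow>
        sectional_curvature (g \<phi>) x u (Jc u) = k)"

section \<open>Real hypersurfaces\<close>

text \<open>A real hypersurface is a manifold \<open>(\<B>, h)\<close> of real codimension one, isometrically immersed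
  by \<open>f\<close>. Since \<open>h\<close> is positive definite, the metric condition says both that \<open>f\<close> is an
  immersion and that \<open>h\<close> is the metric induced by it; embedded hypersurfaces are included.\<close>

definition real_hypersurface ::
  "('a::topological_space, complex ^ 'n) chart set \<Rightarrow>
   (('a, complex ^ 'n) chart \<Rightarrow> (complex ^ 'n) metric) \<Rightarrow>
   ('m::topological_space, 'e::euclidean_space) chart set \<Rightarrow> (('m, 'e) chart \<Rightarrow> 'e metric) \<Rightarrow>
   ('m \<Rightarrow> 'a) \<Rightarrow> bool" where
  "real_hypersurface \<A> g \<B> h f \<longleftrightarrow>
     DIM('e) + 1 = 2 * CARD('n) \<and> riemannian_manifold \<B> h \<and> continuous_on UNIV f \<and>
     (\<forall>\<phi>\<in>\<B>. \<forall>\<psi>\<in>\<A>. smooth_on (in_charts \<phi> \<psi> f) (snd \<phi> ` (fst \<phi> \<inter> f -` fst \<psi>)) \<and>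
        (\<forall>x\<in>snd \<phi> ` (fst \<phi> \<inter> f -` fst \<psi>). \<forall>u v.
           h \<phi> x u v =
           g \<psi> (in_charts \<phi> \<psi> f x)
             (frechet_derivative (in_charts \<phi> \<psi> f) (at x) u)
             (frechet_derivative (in_charts \<phi> \<psi> f) (at x) v)))"

text \<open>From here on \<open>G\<close> is the ambient metric in a chart, \<open>F\<close> the coordinate expression of the
  immersion, and \<open>N\<close> that of a vector field along it (so \<open>N x\<close> is tangent to the ambient space at
  \<open>F x\<close>).\<close>

definition unit_normal_on ::
  "'b::euclidean_space metric \<Rightarrow> ('e::euclidean_space \<Rightarrow> 'b) \<Rightarrow> 'e set \<Rightarrow> ('e \<Rightarrow> 'b) \<Rightarrow> bool" where
  "unit_normal_on G F S N \<longleftrightarrow> smooth_on N S \<and>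
     (\<forall>x\<in>S. G (F x) (N x) (N x) = 1 \<and>
        (\<forall>u. G (F x) (N x) (frechet_derivative F (at x) u) = 0))"

definition cov_deriv_along ::
  "'b::euclidean_space metric \<Rightarrow> ('e::euclidean_space \<Rightarrow> 'b) \<Rightarrow> ('e \<Rightarrow> 'b) \<Rightarrow> 'e \<Rightarrow> 'e \<Rightarrow> 'b" where
  "cov_deriv_along G F Y x u =
     frechet_derivative Y (at x) u + christoffel G (F x) (frechet_derivative F (at x) u) (Y x)"

text \<open>The endomorphism \<open>A\<close> of the tangent space of the hypersurface with
  \<open>dF (A u) = - \<nabla>\<^sub>u N\<close>, where \<open>\<nabla>\<close> is the ambient connection.\<close>

definition shape_operator ::
  "'b::euclidean_space metric \<Rightarrow> ('e::euclidean_space \<Rightarrow> 'b) \<Rightarrow> ('e \<Rightarrow> 'b) \<Rightarrow> 'e \<Rightarrow> 'e \<Rightarrow> 'e" where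
  "shape_operator G F N x u =
     (THE a. frechet_derivative F (at x) a = - cov_deriv_along G F N x u)"

text \<open>The trace of an endomorphism may be computed in any basis, in particular in the standard one
  of the coordinate space.\<close>

definition Tr :: "('e::euclidean_space \<Rightarrow> 'e) \<Rightarrow> real" where
  "Tr L = (\<Sum>b\<in>Basis. L b \<bullet> b)"

definition mean_curvature_vector ::
  "'b::euclidean_space metric \<Rightarrow> ('e::euclidean_space \<Rightarrow> 'b) \<Rightarrow> ('e \<Rightarrow> 'b) \<Rightarrow> 'e \<Rightarrow> 'b" where
  "mean_curvature_vector G F N x = (Tr (shape_operator G F N x) / real DIM('e)) *\<^sub>R N x"

text \<open>The tangential component of \<open>J (dF u)\<close>, as a tangent vector of the hypersurface; \<open>\<nu>\<close> is the
  normal component.\<close>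

definition tangential_J ::
  "(complex ^ 'n) metric \<Rightarrow> ('e::euclidean_space \<Rightarrow> complex ^ 'n) \<Rightarrow> 'e \<Rightarrow> 'e \<Rightarrow> 'e" where
  "tangential_J G F x u =
     (THE z. \<exists>\<nu>. (\<forall>w. G (F x) \<nu> (frechet_derivative F (at x) w) = 0) \<and>
        Jc (frechet_derivative F (at x) u) = frechet_derivative F (at x) z + \<nu>)"

section \<open>Matrices of endomorphisms\<close>

text \<open>The matrix \<open>a\<close> (rows and columns indexed from \<open>1\<close>) represents \<open>L\<close> in the basis \<open>e\<close>.\<close>

definition represented_by ::
  "('e::euclidean_space \<Rightarrow> 'e) \<Rightarrow> (nat \<Rightarrow> 'e) \<Rightarrow> (nat \<Rightarrow> nat \<Rightarrow> real) \<Rightarrow> bool" where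
  "represented_by L e a \<longleftrightarrow>
     (\<forall>j\<in>{1..DIM('e)}. L (e j) = (\<Sum>i=1..DIM('e). a i j *\<^sub>R e i))"

text \<open>The block diagonal matrix of size \<open>m + 1\<close> with blocks \<open>B\<close> (of size \<open>m\<close>) and \<open>\<mu>\<close>.\<close>

definition block_diag :: "nat \<Rightarrow> (nat \<Rightarrow> nat \<Rightarrow> real) \<Rightarrow> real \<Rightarrow> nat \<Rightarrow> nat \<Rightarrow> real" where
  "block_diag m B \<mu> i j =
     (if i \<le> m \<and> j \<le> m then B i j else if i = m + 1 \<and> j = m + 1 then \<mu> else 0)"

end

theory Submission
  imports Defs
begin

text \<open>Write \<open>b\<close> for the second fundamental form and \<open>A\<close> for the shape operator, so that
  \<open>b(u, v) = \<langle>A u, v\<rangle>\<close>. Two facts reduce the theorem to a completion of the square.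

  First, in a Kaehler manifold of constant holomorphic sectional curvature \<open>4c\<close>, polarization and
  the symmetries of the curvature tensor determine all sectional curvatures:
  \<open>\<langle>R(u,v)v, u\<rangle> = c (|u|\<^sup>2|v|\<^sup>2 - \<langle>u,v\<rangle>\<^sup>2 + 3 \<langle>u,Jv\<rangle>\<^sup>2)\<close> (\<open>constant_holomorphic_curvature\<close>).
  Secondly, the Gauss equation (\<open>gauss_equation\<close>) expresses the curvature of the hypersurface by the
  ambient curvature and \<open>b\<close>. Summing over an orthonormal basis \<open>e\<^sub>j\<close> of the tangent space, and using
  \<open>\<langle>e\<^sub>j, J X\<rangle> = \<langle>e\<^sub>j, \<phi>X\<rangle>\<close>, gives for a unit vector \<open>X\<close> (\<open>ricci_curvature\<close>)
  \<open>Ric(X) = c (2n - 2 + 3 |\<phi>X|\<^sup>2) + Tr(A) \<kappa> - |A X|\<^sup>2\<close>, where \<open>\<kappa> = \<langle>A X, X\<rangle>\<close>.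

  Since \<open>(2n-1)\<^sup>2 |H|\<^sup>2 = Tr(A)\<^sup>2\<close>, the difference of the two sides of the claimed inequality is
  \<open>(Tr(A) - 4\<kappa>)\<^sup>2 / 8 + |A X - \<kappa>X|\<^sup>2\<close>. It is nonnegative, and it vanishes exactly if \<open>X\<close> is an
  eigenvector of \<open>A\<close> with eigenvalue \<open>Tr(A) / 4\<close>; in an orthonormal basis whose last member is
  \<open>X\<close> this is the block form with \<open>Tr(B) = 3\<mu>\<close> (\<open>trace_inequality\<close>).

  Curvature is given in coordinates, through derivatives of Christoffel symbols which are themselves
  only characterized by the Koszul formula. Two analytic facts make the classical computations
  legitimate: second derivatives of smooth maps are symmetric, and the solution of a linear equation
  \<open>\<langle>z, w\<rangle>\<^sub>x = k\<^sub>x(w)\<close> depends differentiably on \<open>x\<close> if its data do (\<open>riesz_differentiable\<close>).\<close>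

section \<open>Symmetry of the second derivative\<close>

abbreviation dd :: "('a::real_normed_vector \<Rightarrow> 'b::real_normed_vector) \<Rightarrow> 'a \<Rightarrow> 'a \<Rightarrow> 'b" where
  "dd f x \<equiv> frechet_derivative f (at x)"

lemma smooth_on_differentiable: "smooth_on f S \<Longrightarrow> x \<in> S \<Longrightarrow> f differentiable (at x)"
  unfolding smooth_on_def by (metis Ck_on.simps(2))

lemma smooth_on_dd: "smooth_on f S \<Longrightarrow> smooth_on (\<lambda>x. dd f x v) S"
  unfolding smooth_on_def by (metis Ck_on.simps(2))

lemma smooth_on_continuous: "smooth_on f S \<Longrightarrow> continuous_on S f"
  unfolding smooth_on_def by (metis Ck_on.simps(1))

lemma smooth_on_subset: "smooth_on f S \<Longrightarrow> T \<subseteq> S \<Longrightarrow> smooth_on f T"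
proof -
  have "Ck_on k f S \<Longrightarrow> T \<subseteq> S \<Longrightarrow> Ck_on k f T" for k
    by (induction k arbitrary: f) (auto intro: continuous_on_subset)
  then show "smooth_on f S \<Longrightarrow> T \<subseteq> S \<Longrightarrow> smooth_on f T"
    unfolding smooth_on_def by blast
qed

lemma dd_eqI: "(f has_derivative f') (at x) \<Longrightarrow> dd f x u = f' u"
  by (metis frechet_derivative_at)

lemma has_derivative_dd: "f differentiable (at x) \<Longrightarrow> (f has_derivative dd f x) (at x)"
  by (simp add: frechet_derivative_works)

text \<open>The derivative is a choice among all candidates, and the two functions have the same candidates.\<close>

lemma dd_cong:
  assumes "open S" "x \<in> S" "\<And>y. y \<in> S \<Longrightarrow> f y = g y"
  shows "dd f x = dd g x"
proof -
  have "(f has_derivative f') (at x) \<longleftrightarrow> (g has_derivative f') (at x)" for f'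
    using assms by (metis has_derivative_transform_within_open)
  then show ?thesis
    unfolding frechet_derivative_def by simp
qed

lemma dd_inner:
  fixes f :: "'a::real_normed_vector \<Rightarrow> 'b::real_inner"
  assumes "f differentiable (at x)"
  shows "dd (\<lambda>y. f y \<bullet> b) x u = dd f x u \<bullet> b"
  by (rule dd_eqI) (rule has_derivative_inner_left[OF has_derivative_dd[OF assms]])

text \<open>The mean value theorem in the direction \<open>u\<close>, for the increment in the direction \<open>v\<close>, and then
  in the direction \<open>v\<close>. The left side is symmetric in \<open>u\<close> and \<open>v\<close>, so that letting \<open>r\<close> tend to
  \<open>0\<close> identifies the two iterated derivatives.\<close>

lemma second_difference_mean_value:
  fixes f :: "'a::real_normed_vector \<Rightarrow> real" and x u v :: 'a and r :: real
  assumes f: "\<And>y. y \<in> S \<Longrightarrow> f differentiable (at y)"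
    and fu: "\<And>y. y \<in> S \<Longrightarrow> (\<lambda>y. dd f y u) differentiable (at y)"
    and "0 < r" and S: "\<And>s t. 0 \<le> s \<Longrightarrow> s \<le> r \<Longrightarrow> 0 \<le> t \<Longrightarrow> t \<le> r \<Longrightarrow> x + s *\<^sub>R u + t *\<^sub>R v \<in> S"
  obtains s t where "0 < s" "s < r" "0 < t" "t < r"
    "f (x + r *\<^sub>R u + r *\<^sub>R v) - f (x + r *\<^sub>R u) - f (x + r *\<^sub>R v) + f x
     = r\<^sup>2 * dd (\<lambda>y. dd f y u) (x + s *\<^sub>R u + t *\<^sub>R v) v"
proof -
  have line: "((\<lambda>s. F (y + s *\<^sub>R w)) has_real_derivative dd F (y + s *\<^sub>R w) w) (at s)"
    if "F differentiable (at (y + s *\<^sub>R w))" for F :: "'a \<Rightarrow> real" and y w s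
  proof -
    have 1: "((\<lambda>s. y + s *\<^sub>R w) has_derivative (\<lambda>s. s *\<^sub>R w)) (at s)"
      by (auto intro!: derivative_eq_intros)
    have 2: "linear (dd F (y + s *\<^sub>R w))"
      by (rule linear_frechet_derivative[OF that])
    from has_derivative_compose[OF 1 has_derivative_dd[OF that]]
    show ?thesis
      by (rule has_derivative_imp_has_field_derivative) (simp add: linear_cmul[OF 2])
  qed
  define k where "k s = f ((x + r *\<^sub>R v) + s *\<^sub>R u) - f (x + s *\<^sub>R u)" for s
  have "\<exists>s>0. s < r \<and> k r - k 0 = (r - 0) * (dd f ((x + r *\<^sub>R v) + s *\<^sub>R u) u - dd f (x + s *\<^sub>R u) u)"
  proof (rule MVT2)
    fix s :: real assume s: "0 \<le> s" "s \<le> r"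
    have "(x + r *\<^sub>R v) + s *\<^sub>R u \<in> S" "x + s *\<^sub>R u \<in> S"
      using S[of s r] S[of s 0] s \<open>0 < r\<close> by (simp_all add: algebra_simps)
    then show "(k has_real_derivative dd f ((x + r *\<^sub>R v) + s *\<^sub>R u) u - dd f (x + s *\<^sub>R u) u) (at s)"
      unfolding k_def by (intro DERIV_diff line f)
  qed (use \<open>0 < r\<close> in auto)
  then obtain s where s: "0 < s" "s < r"
    "k r - k 0 = r * (dd f ((x + s *\<^sub>R u) + r *\<^sub>R v) u - dd f ((x + s *\<^sub>R u) + 0 *\<^sub>R v) u)"
    by (auto simp: algebra_simps)
  have "\<exists>t>0. t < r \<and> dd f ((x + s *\<^sub>R u) + r *\<^sub>R v) u - dd f ((x + s *\<^sub>R u) + 0 *\<^sub>R v) u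
    = (r - 0) * dd (\<lambda>y. dd f y u) ((x + s *\<^sub>R u) + t *\<^sub>R v) v"
    using S s \<open>0 < r\<close> by (intro MVT2 line[where F="\<lambda>y. dd f y u"] fu) auto
  then obtain t where t: "0 < t" "t < r" "dd f ((x + s *\<^sub>R u) + r *\<^sub>R v) u - dd f ((x + s *\<^sub>R u) + 0 *\<^sub>R v) u
    = r * dd (\<lambda>y. dd f y u) ((x + s *\<^sub>R u) + t *\<^sub>R v) v"
    by auto
  show ?thesis
    using s t by (intro that[of s t]) (simp_all add: k_def algebra_simps power2_eq_square)
qed

lemma second_difference_limit:
  fixes f :: "'a::real_normed_vector \<Rightarrow> real" and x u v :: 'a
  assumes "smooth_on f S" "open S" "x \<in> S"
  shows "((\<lambda>r. (f (x + r *\<^sub>R u + r *\<^sub>R v) - f (x + r *\<^sub>R u) - f (x + r *\<^sub>R v) + f x) / r\<^sup>2)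
          \<longlongrightarrow> dd (\<lambda>y. dd f y u) x v) (at_right 0)"
proof (rule tendstoI)
  fix e :: real assume "e > 0"
  let ?g = "\<lambda>y. dd (\<lambda>y. dd f y u) y v"
  have "continuous_on S ?g"
    using assms(1) by (intro smooth_on_continuous smooth_on_dd)
  then have "isCont ?g x"
    using assms by (simp add: continuous_on_eq_continuous_at)
  then obtain d1 where d1: "d1 > 0" "\<And>y. dist y x < d1 \<Longrightarrow> dist (?g y) (?g x) < e"
    using \<open>e > 0\<close> unfolding continuous_at_eps_delta by blast
  obtain d2 where d2: "d2 > 0" "ball x d2 \<subseteq> S"
    using assms openE by blast
  define d where "d = min d1 d2 / (norm u + norm v + 1)"
  have nuv: "norm u + norm v + 1 > 0" by (simp add: add_nonneg_pos)
  have "d > 0" using d1 d2 nuv by (simp add: d_def)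
  have small: "dist (x + s *\<^sub>R u + t *\<^sub>R v) x < min d1 d2"
    if "0 \<le> s" "s \<le> r" "0 \<le> t" "t \<le> r" "r < d" for s t r
  proof -
    have "dist (x + s *\<^sub>R u + t *\<^sub>R v) x = norm (s *\<^sub>R u + t *\<^sub>R v)"
      by (simp add: dist_norm)
    also have "\<dots> \<le> r * norm u + r * norm v"
      using that norm_triangle_le[of "s *\<^sub>R u" "t *\<^sub>R v"]
      by (smt (verit, best) mult_right_mono norm_ge_zero norm_scaleR norm_triangle_ineq)
    also have "\<dots> \<le> r * (norm u + norm v + 1)"
      using that by (simp add: algebra_simps)
    also have "\<dots> < d * (norm u + norm v + 1)"
      using that nuv by (intro mult_strict_right_mono) auto
    also have "\<dots> = min d1 d2" using nuv by (simp add: d_def)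
    finally show ?thesis .
  qed
  have "dist ((f (x + r *\<^sub>R u + r *\<^sub>R v) - f (x + r *\<^sub>R u) - f (x + r *\<^sub>R v) + f x) / r\<^sup>2) (?g x) < e"
    if r: "0 < r" "r < d" for r
  proof -
    have S: "x + s *\<^sub>R u + t *\<^sub>R v \<in> S" if "0 \<le> s" "s \<le> r" "0 \<le> t" "t \<le> r" for s t
      using small[OF that r(2)] d2 by (auto simp: dist_commute)
    obtain s t where st: "0 < s" "s < r" "0 < t" "t < r"
      "f (x + r *\<^sub>R u + r *\<^sub>R v) - f (x + r *\<^sub>R u) - f (x + r *\<^sub>R v) + f x
       = r\<^sup>2 * ?g (x + s *\<^sub>R u + t *\<^sub>R v)"
      by (rule second_difference_mean_value[of S f u r x v, OF smooth_on_differentiable[OF assms(1)]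
          smooth_on_differentiable[OF smooth_on_dd[OF assms(1)]] r(1) S])
    then show ?thesis
      using d1(2) small[of s r t] r by simp
  qed
  then show "\<forall>\<^sub>F r in at_right 0. dist ((f (x + r *\<^sub>R u + r *\<^sub>R v) - f (x + r *\<^sub>R u)
      - f (x + r *\<^sub>R v) + f x) / r\<^sup>2) (?g x) < e"
    using \<open>d > 0\<close> by (auto simp: eventually_at_right_field)
qed

lemma second_derivative_symmetric_real:
  fixes f :: "'a::real_normed_vector \<Rightarrow> real"
  assumes "smooth_on f S" "open S" "x \<in> S"
  shows "dd (\<lambda>y. dd f y u) x v = dd (\<lambda>y. dd f y v) x u"
proof -
  have "((\<lambda>r. (f (x + r *\<^sub>R u + r *\<^sub>R v) - f (x + r *\<^sub>R u) - f (x + r *\<^sub>R v) + f x) / r\<^sup>2)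
          \<longlongrightarrow> dd (\<lambda>y. dd f y v) x u) (at_right 0)"
    using second_difference_limit[OF assms, of v u] by (simp add: algebra_simps)
  with second_difference_limit[OF assms, of u v] show ?thesis
    by (intro tendsto_unique[of "at_right (0::real)"]) auto
qed

text \<open>Reduces statements about maps to the real-valued case.\<close>

lemma smooth_on_inner:
  fixes f :: "'a::real_normed_vector \<Rightarrow> 'b::real_inner"
  assumes "smooth_on f S" "open S"
  shows "smooth_on (\<lambda>y. f y \<bullet> b) S"
proof -
  have cong: "Ck_on k f S \<Longrightarrow> (\<And>y. y \<in> S \<Longrightarrow> f y = g y) \<Longrightarrow> Ck_on k g S" for k and f g :: "'a \<Rightarrow> real"
  proof (induction k arbitrary: f g)
    case (Suc k)
    have "g differentiable at x" if "x \<in> S" for x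
      using Suc.prems that assms(2) unfolding differentiable_def
      by (metis Ck_on.simps(2) differentiable_def has_derivative_transform_within_open)
    moreover have "Ck_on k (\<lambda>x. dd g x v) S" for v
    proof (rule Suc.IH[of "\<lambda>x. dd f x v"])
      show "Ck_on k (\<lambda>x. dd f x v) S"
        using Suc.prems(1) by simp
      show "dd f x v = dd g x v" if "x \<in> S" for x
        using dd_cong[OF assms(2) that, of f g] Suc.prems(2) by simp
    qed
    ultimately show ?case by simp
  qed (metis Ck_on.simps(1) continuous_on_cong)
  have "Ck_on k f S \<Longrightarrow> Ck_on k (\<lambda>y. f y \<bullet> b) S" for k and f :: "'a \<Rightarrow> 'b"
  proof (induction k arbitrary: f)
    case (Suc k)
    then have f: "f differentiable at x" if "x \<in> S" for x
      using that by simp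
    have "(\<lambda>y. f y \<bullet> b) differentiable at x" if "x \<in> S" for x
      using has_derivative_inner_left[OF has_derivative_dd[OF f[OF that]]] by (rule differentiableI)
    moreover have "Ck_on k (\<lambda>x. dd (\<lambda>y. f y \<bullet> b) x v) S" for v
    proof (rule cong)
      show "Ck_on k (\<lambda>x. dd f x v \<bullet> b) S"
        using Suc by simp
    qed (simp add: dd_inner[OF f])
    ultimately show ?case by simp
  qed (auto intro: continuous_intros)
  then show ?thesis
    using assms(1) unfolding smooth_on_def by blast
qed

lemma second_derivative_symmetric:
  fixes f :: "'a::real_normed_vector \<Rightarrow> 'b::euclidean_space"
  assumes f: "smooth_on f S" "open S" "x \<in> S"
  shows "dd (\<lambda>y. dd f y u) x v = dd (\<lambda>y. dd f y v) x u"
proof (rule euclidean_eqI)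
  fix b :: 'b assume "b \<in> Basis"
  have "dd (\<lambda>y. dd f y u) x v \<bullet> b = dd (\<lambda>y. dd (\<lambda>z. f z \<bullet> b) y u) x v" for u v
  proof -
    have "dd (\<lambda>y. dd f y u) x v \<bullet> b = dd (\<lambda>y. dd f y u \<bullet> b) x v"
      using f by (simp add: dd_inner smooth_on_differentiable[OF smooth_on_dd])
    also have "\<dots> = dd (\<lambda>y. dd (\<lambda>z. f z \<bullet> b) y u) x v"
      using f by (subst dd_cong[of S]) (auto simp: dd_inner smooth_on_differentiable)
    finally show ?thesis .
  qed
  then show "dd (\<lambda>y. dd f y u) x v \<bullet> b = dd (\<lambda>y. dd f y v) x u \<bullet> b"
    using second_derivative_symmetric_real[OF smooth_on_inner[OF f(1,2)] f(2,3)] by metis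
qed

section \<open>Differentiable families of bilinear maps\<close>

lemma bilinear_expand:
  fixes B :: "'b::euclidean_space \<Rightarrow> 'c::euclidean_space \<Rightarrow> 'd::real_normed_vector"
  assumes "bilinear B"
  shows "B a b = (\<Sum>i\<in>Basis. \<Sum>j\<in>Basis. ((a \<bullet> i) * (b \<bullet> j)) *\<^sub>R B i j)"
proof -
  have "B a b = B (\<Sum>i\<in>Basis. (a \<bullet> i) *\<^sub>R i) (\<Sum>j\<in>Basis. (b \<bullet> j) *\<^sub>R j)"
    by (simp add: euclidean_representation)
  also have "\<dots> = (\<Sum>i\<in>Basis. \<Sum>j\<in>Basis. ((a \<bullet> i) * (b \<bullet> j)) *\<^sub>R B i j)"
    unfolding bilinear_sum[OF assms] sum.cartesian_product
    by (rule sum.cong) (auto simp: bilinear_lmul[OF assms] bilinear_rmul[OF assms])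
  finally show ?thesis .
qed

text \<open>Both a metric and its Christoffel symbols are bilinear maps depending on a point, differentiable
  for fixed arguments; this is the common product rule for such families.\<close>

locale bilinear_field =
  fixes T :: "'b::euclidean_space set"
    and B :: "'b \<Rightarrow> 'c::euclidean_space \<Rightarrow> 'd::euclidean_space \<Rightarrow> 'e::real_normed_vector"
  assumes open_T: "open T"
    and bilin: "y \<in> T \<Longrightarrow> bilinear (B y)"
    and diff_B: "y \<in> T \<Longrightarrow> (\<lambda>y. B y a b) differentiable (at y)"
begin

lemma dd_bilinear: "y \<in> T \<Longrightarrow> bilinear (\<lambda>a b. dd (\<lambda>y. B y a b) y u)"
proof -
  assume y: "y \<in> T"
  have "dd (\<lambda>y. B y (a + a') b) y u = dd (\<lambda>y. B y a b) y u + dd (\<lambda>y. B y a' b) y u" for a a' b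
    by (subst dd_cong[OF open_T y, of _ "\<lambda>y. B y a b + B y a' b"])
      (auto simp: bilinear_ladd[OF bilin] intro!: dd_eqI has_derivative_add has_derivative_dd diff_B y)
  moreover have "dd (\<lambda>y. B y a (b + b')) y u = dd (\<lambda>y. B y a b) y u + dd (\<lambda>y. B y a b') y u" for a b b'
    by (subst dd_cong[OF open_T y, of _ "\<lambda>y. B y a b + B y a b'"])
      (auto simp: bilinear_radd[OF bilin] intro!: dd_eqI has_derivative_add has_derivative_dd diff_B y)
  moreover have "dd (\<lambda>y. B y (r *\<^sub>R a) b) y u = r *\<^sub>R dd (\<lambda>y. B y a b) y u" for a b r
    by (subst dd_cong[OF open_T y, of _ "\<lambda>y. r *\<^sub>R B y a b"])
      (auto simp: bilinear_lmul[OF bilin] intro!: dd_eqI has_derivative_scaleR_right has_derivative_dd diff_B y)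
  moreover have "dd (\<lambda>y. B y a (r *\<^sub>R b)) y u = r *\<^sub>R dd (\<lambda>y. B y a b) y u" for a b r
    by (subst dd_cong[OF open_T y, of _ "\<lambda>y. r *\<^sub>R B y a b"])
      (auto simp: bilinear_rmul[OF bilin] intro!: dd_eqI has_derivative_scaleR_right has_derivative_dd diff_B y)
  ultimately show ?thesis
    unfolding bilinear_def by (auto intro!: linearI)
qed

text \<open>Expanding the bilinear map in the standard bases turns this into the product rule for finitely
  many real factors.\<close>

lemma has_derivative_along:
  assumes x: "x \<in> S" and S: "open S" "\<And>y. y \<in> S \<Longrightarrow> F y \<in> T"
    and F: "(F has_derivative F') (at x)"
    and Y: "(Y has_derivative Y') (at x)" and Z: "(Z has_derivative Z') (at x)"
  shows "((\<lambda>x. B (F x) (Y x) (Z x)) has_derivative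
    (\<lambda>u. dd (\<lambda>y. B y (Y x) (Z x)) (F x) (F' u) + B (F x) (Y' u) (Z x) + B (F x) (Y x) (Z' u))) (at x)"
proof -
  have Fx: "F x \<in> T" using S x by auto
  have BF: "((\<lambda>x. B (F x) i j) has_derivative (\<lambda>u. dd (\<lambda>y. B y i j) (F x) (F' u))) (at x)" for i j
    by (rule has_derivative_compose[OF F has_derivative_dd[OF diff_B[OF Fx]]])
  have "((\<lambda>x. \<Sum>i\<in>Basis. \<Sum>j\<in>Basis. ((Y x \<bullet> i) * (Z x \<bullet> j)) *\<^sub>R B (F x) i j) has_derivative
      (\<lambda>u. \<Sum>i\<in>Basis. \<Sum>j\<in>Basis. ((Y x \<bullet> i) * (Z x \<bullet> j)) *\<^sub>R dd (\<lambda>y. B y i j) (F x) (F' u)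
         + ((Y x \<bullet> i) * (Z' u \<bullet> j) + (Y' u \<bullet> i) * (Z x \<bullet> j)) *\<^sub>R B (F x) i j)) (at x)"
    by (intro has_derivative_sum has_derivative_scaleR has_derivative_mult BF
        has_derivative_inner_left Y Z)
  then have "((\<lambda>x. B (F x) (Y x) (Z x)) has_derivative
      (\<lambda>u. \<Sum>i\<in>Basis. \<Sum>j\<in>Basis. ((Y x \<bullet> i) * (Z x \<bullet> j)) *\<^sub>R dd (\<lambda>y. B y i j) (F x) (F' u)
         + ((Y x \<bullet> i) * (Z' u \<bullet> j) + (Y' u \<bullet> i) * (Z x \<bullet> j)) *\<^sub>R B (F x) i j)) (at x)"
    by (rule has_derivative_transform_within_open[OF _ S(1) x])
      (simp add: bilinear_expand[OF bilin[OF S(2)], symmetric])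
  moreover have "(\<Sum>i\<in>Basis. \<Sum>j\<in>Basis. ((Y x \<bullet> i) * (Z x \<bullet> j)) *\<^sub>R dd (\<lambda>y. B y i j) (F x) (F' u)
         + ((Y x \<bullet> i) * (Z' u \<bullet> j) + (Y' u \<bullet> i) * (Z x \<bullet> j)) *\<^sub>R B (F x) i j)
      = dd (\<lambda>y. B y (Y x) (Z x)) (F x) (F' u) + B (F x) (Y' u) (Z x) + B (F x) (Y x) (Z' u)" for u
    unfolding bilinear_expand[OF dd_bilinear[OF Fx], of "Y x" "Z x"]
      bilinear_expand[OF bilin[OF Fx], of "Y' u" "Z x"] bilinear_expand[OF bilin[OF Fx], of "Y x" "Z' u"]
    by (simp add: scaleR_add_left sum.distrib add_ac)
  ultimately show ?thesis by (simp only:)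
qed

end

section \<open>Inner products\<close>

locale inner_prod =
  fixes b :: "'e::euclidean_space \<Rightarrow> 'e \<Rightarrow> real"
  assumes inner_prod: "inner_product b"
begin

lemma bil: "bilinear b" and sym: "b u v = b v u" and pos: "u \<noteq> 0 \<Longrightarrow> b u u > 0"
  using inner_prod unfolding inner_product_def by auto

lemmas alg = bilinear_ladd[OF bil] bilinear_radd[OF bil] bilinear_lmul[OF bil] bilinear_rmul[OF bil]
  bilinear_lneg[OF bil] bilinear_rneg[OF bil] bilinear_lzero[OF bil] bilinear_rzero[OF bil]
  bilinear_lsub[OF bil] bilinear_rsub[OF bil]

lemma nonneg: "b u u \<ge> 0" and eq_0_iff: "b u u = 0 \<longleftrightarrow> u = 0"
  using pos[of u] by (cases "u = 0", auto simp: alg)+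

lemma eqI: "(\<And>w. b u w = b v w) \<Longrightarrow> u = v"
  using eq_0_iff[of "u - v"] by (simp add: alg)

text \<open>The musical isomorphism, with covectors represented by means of the standard inner product.\<close>

definition flat :: "'e \<Rightarrow> 'e" where
  "flat z = (\<Sum>i\<in>Basis. b z i *\<^sub>R i)"

lemma linear_flat: "linear flat"
  by (rule linearI) (simp_all add: flat_def alg sum.distrib scaleR_add_left scaleR_sum_right)

lemma flat_inner: "flat z \<bullet> w = b z w"
proof -
  have "flat z \<bullet> w = b z (\<Sum>i\<in>Basis. (w \<bullet> i) *\<^sub>R i)"
    using linear_sum[of "b z" "\<lambda>i. (w \<bullet> i) *\<^sub>R i" Basis] bil
    by (simp add: flat_def bilinear_def inner_sum_left inner_sum_right inner_commute[of _ w] linear_cmul mult.commute)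
  then show ?thesis by (simp add: euclidean_representation)
qed

lemma inj_flat: "inj flat"
  by (rule injI) (metis eqI flat_inner)

lemma riesz:
  assumes "linear k"
  shows "\<exists>!z. \<forall>w. b z w = k w"
proof -
  have "surj flat"
    using linear_injective_imp_surjective linear_flat inj_flat by blast
  then obtain z where z: "flat z = (\<Sum>i\<in>Basis. k i *\<^sub>R i)"
    by (metis surjD)
  have "b z w = k w" for w
  proof -
    have "b z w = (\<Sum>i\<in>Basis. (w \<bullet> i) * k i)"
      unfolding flat_inner[symmetric] z by (simp add: inner_sum_right inner_commute[of _ w] mult.commute)
    also have "\<dots> = k (\<Sum>i\<in>Basis. (w \<bullet> i) *\<^sub>R i)"
      using assms by (simp add: linear_sum linear_cmul)
    finally show ?thesis by (simp add: euclidean_representation)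
  qed
  then show ?thesis by (metis eqI)
qed

end

text \<open>At a zero of \<open>p\<close> continuity of \<open>q\<close> suffices: since \<open>p y = O(|y - x|)\<close>, replacing
  \<open>q y\<close> by \<open>q x\<close> changes the product by \<open>o(|y - x|)\<close>.\<close>

lemma has_derivative_continuous_times_vanishing:
  fixes p :: "'a::real_normed_vector \<Rightarrow> real" and q :: "'a \<Rightarrow> real"
  assumes p: "(p has_derivative p') (at x)" "p x = 0" and q: "isCont q x"
  shows "((\<lambda>y. q y * p y) has_derivative (\<lambda>u. q x * p' u)) (at x)"
proof -
  have "((\<lambda>y. (q y - q x) * p y) has_derivative (\<lambda>u. 0)) (at x)"
    unfolding has_derivative_at_alt
  proof (intro conjI allI impI)
    fix e :: real assume "e > 0"
    obtain K where K: "K > 0" "\<And>u. norm (p' u) \<le> norm u * K"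
      using has_derivative_bounded_linear[OF p(1)] bounded_linear.pos_bounded by blast
    obtain d1 where d1: "d1 > 0" "\<And>y. norm (y - x) < d1 \<Longrightarrow> norm (p y - p x - p' (y - x)) \<le> 1 * norm (y - x)"
      using p(1) unfolding has_derivative_at_alt by (metis zero_less_one)
    have "e / (1 + K) > 0" using \<open>e > 0\<close> K by simp
    then obtain d2 where d2: "d2 > 0" "\<And>y. dist y x < d2 \<Longrightarrow> dist (q y) (q x) < e / (1 + K)"
      using q unfolding continuous_at_eps_delta by blast
    have "norm ((q y - q x) * p y - (q x - q x) * p x - 0) \<le> e * norm (y - x)"
      if "norm (y - x) < min d1 d2" for y
    proof -
      have "\<bar>p y\<bar> \<le> (1 + K) * norm (y - x)"
        using d1(2)[of y] K(2)[of "y - x"] that p(2) by (simp add: algebra_simps)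
      moreover have "\<bar>q y - q x\<bar> \<le> e / (1 + K)"
        using d2(2)[of y] that by (simp add: dist_norm)
      ultimately have "\<bar>q y - q x\<bar> * \<bar>p y\<bar> \<le> e / (1 + K) * ((1 + K) * norm (y - x))"
        using K by (intro mult_mono) auto
      then show ?thesis using K by (simp add: abs_mult)
    qed
    then show "\<exists>d>0. \<forall>y. norm (y - x) < d \<longrightarrow>
        norm ((q y - q x) * p y - (q x - q x) * p x - 0) \<le> e * norm (y - x)"
      using d1(1) d2(1) by (intro exI[of _ "min d1 d2"]) auto
  qed (rule bounded_linear_zero)
  then have "((\<lambda>y. q x * p y + (q y - q x) * p y) has_derivative (\<lambda>u. q x * p' u + 0)) (at x)"
    by (intro has_derivative_add has_derivative_mult_right p(1))
  then show ?thesis by (simp add: algebra_simps)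
qed

text \<open>Let \<open>M\<^sub>y\<close> be the operator representing \<open>B y\<close>, so that the hypothesis on \<open>z\<close> reads \<open>M\<^sub>y z\<^sub>y = \<kappa>\<^sub>y\<close>,
  equivalently \<open>z\<^sub>y = M\<^sub>x\<^sup>-\<^sup>1 (\<kappa>\<^sub>y - (M\<^sub>y - M\<^sub>x) z\<^sub>y)\<close>. This identity shows in turn that \<open>z\<close> is bounded near
  \<open>x\<close>, that it is continuous at \<open>x\<close>, and, since \<open>M\<^sub>y - M\<^sub>x\<close> vanishes at \<open>x\<close>, that it is
  differentiable there.\<close>

lemma riesz_differentiable:
  fixes B :: "'b::euclidean_space \<Rightarrow> 'c::euclidean_space \<Rightarrow> 'c \<Rightarrow> real"
  assumes "bilinear_field T B" and ip: "\<And>y. y \<in> T \<Longrightarrow> inner_product (B y)" and x: "x \<in> T"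
    and k: "\<And>w. (\<lambda>y. k y w) differentiable (at x)"
    and z: "\<And>y w. y \<in> T \<Longrightarrow> B y (z y) w = k y w"
  shows "z differentiable (at x)"
proof -
  interpret bilinear_field T B by fact
  interpret inner_prod "B x" by unfold_locales (rule ip[OF x])
  obtain L where L: "linear L" "\<And>v. L (flat v) = v"
    using linear_injective_left_inverse[OF linear_flat inj_flat] by (metis comp_apply id_apply)
  have Lcont: "bounded_linear L" using L(1) by (simp add: linear_conv_bounded_linear)
  define kap where "kap y = (\<Sum>i\<in>Basis. k y i *\<^sub>R i)" for y
  define E where "E y v = (\<Sum>i\<in>Basis. \<Sum>j\<in>Basis. ((v \<bullet> j) * (B y j i - B x j i)) *\<^sub>R i)" for y v
  have kap_diff: "kap differentiable (at x)"
    unfolding kap_def by (intro differentiable_sum differentiable_scaleR k differentiable_const ballI finite_Basis)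
  have E: "E y v = (\<Sum>i\<in>Basis. (B y v i - B x v i) *\<^sub>R i)" if "y \<in> T" for y v
  proof -
    have *: "B y v i = (\<Sum>j\<in>Basis. (v \<bullet> j) * B y j i)" if "y \<in> T" for y i
    proof -
      have "B y v i = B y (\<Sum>j\<in>Basis. (v \<bullet> j) *\<^sub>R j) i" by (simp add: euclidean_representation)
      also have "\<dots> = (\<Sum>j\<in>Basis. (v \<bullet> j) * B y j i)"
        using bilin[OF that] linear_sum[of "\<lambda>a. B y a i" "\<lambda>j. (v \<bullet> j) *\<^sub>R j" Basis]
        by (simp add: bilinear_def linear_cmul[of "\<lambda>a. B y a i"])
      finally show ?thesis .
    qed
    show ?thesis
      unfolding E_def *[OF that] *[OF x] scaleR_sum_left[symmetric]
      by (simp add: sum_subtractf algebra_simps)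
  qed
  have zL: "z y = L (kap y - E y (z y))" if "y \<in> T" for y
  proof -
    have "flat (z y) = kap y - E y (z y)"
      unfolding E[OF that] flat_def kap_def by (simp add: z[OF that] scaleR_diff_left sum_subtractf)
    then show ?thesis by (metis L(2))
  qed
  have Btend: "((\<lambda>y. B y j i) \<longlongrightarrow> B x j i) (at x)" for i j
    using differentiable_imp_continuous_within[OF diff_B[OF x]] by (simp add: continuous_at)
  define eps where "eps y = (\<Sum>i\<in>(Basis::'c set). \<Sum>j\<in>(Basis::'c set). \<bar>B y j i - B x j i\<bar>)" for y
  have "((\<lambda>y. eps y) \<longlongrightarrow> (\<Sum>i\<in>(Basis::'c set). \<Sum>j\<in>(Basis::'c set). \<bar>B x j i - B x j i\<bar>)) (at x)"
    unfolding eps_def by (intro tendsto_intros Btend)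
  then have eps0: "(eps \<longlongrightarrow> 0) (at x)" by simp
  have eps_nonneg: "eps y \<ge> 0" for y unfolding eps_def by (intro sum_nonneg) auto
  have Ebound: "norm (E y v) \<le> eps y * norm v" for y v
  proof -
    have "norm (E y v) \<le> (\<Sum>i\<in>Basis. \<Sum>j\<in>Basis. norm (((v \<bullet> j) * (B y j i - B x j i)) *\<^sub>R i))"
      unfolding E_def by (intro order_trans[OF norm_sum] sum_mono) auto
    also have "\<dots> \<le> (\<Sum>i\<in>Basis. \<Sum>j\<in>Basis. \<bar>B y j i - B x j i\<bar> * norm v)"
      by (intro sum_mono) (simp add: abs_mult mult.commute[of _ "norm v"] mult_right_mono Basis_le_norm)
    also have "\<dots> = eps y * norm v" by (simp add: eps_def sum_distrib_right)
    finally show ?thesis .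
  qed
  obtain K where K: "K > 0" "\<And>v. norm (L v) \<le> norm v * K"
    using bounded_linear.pos_bounded[OF Lcont] by blast
  have kap_tend: "(kap \<longlongrightarrow> kap x) (at x)"
    using differentiable_imp_continuous_within[OF kap_diff] by (simp add: continuous_at)
  have evT: "\<forall>\<^sub>F y in at x. y \<in> T"
    using x open_T by (simp add: eventually_at_in_open')
  (* Below this threshold the term E y (z y) is at most half of z y and can be absorbed. *)
  have ev_eps: "\<forall>\<^sub>F y in at x. eps y < 1 / (2 * K)"
    using order_tendstoD(2)[OF eps0, of "1 / (2 * K)"] K by simp
  have ev_bound: "\<forall>\<^sub>F y in at x. norm (z y) \<le> 2 * K * norm (kap y)"
    using evT ev_eps
  proof eventually_elim
    case (elim y)
    have "norm (z y) \<le> norm (kap y - E y (z y)) * K"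
      using zL[OF elim(1)] K(2) by metis
    also have "\<dots> \<le> (norm (kap y) + eps y * norm (z y)) * K"
      using K Ebound[of y "z y"] norm_triangle_ineq4[of "kap y" "E y (z y)"]
      by (intro mult_right_mono) auto
    also have "\<dots> \<le> (norm (kap y) + 1 / (2 * K) * norm (z y)) * K"
      using K elim(2) by (intro mult_right_mono add_left_mono) auto
    also have "\<dots> = K * norm (kap y) + norm (z y) / 2"
      using K by (simp add: field_simps)
    finally show ?case by simp
  qed
  have E_tend: "((\<lambda>y. E y (z y)) \<longlongrightarrow> 0) (at x)"
  proof (rule Lim_null_comparison)
    show "\<forall>\<^sub>F y in at x. norm (E y (z y)) \<le> eps y * (2 * K * norm (kap y))"
      using ev_bound
    proof eventually_elim
      case (elim y)
      show ?case
        using Ebound[of y "z y"] mult_left_mono[OF elim eps_nonneg[of y]] by linarith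
    qed
    have "((\<lambda>y. eps y * (2 * K * norm (kap y))) \<longlongrightarrow> 0 * (2 * K * norm (kap x))) (at x)"
      by (intro tendsto_intros eps0 kap_tend)
    then show "((\<lambda>y. eps y * (2 * K * norm (kap y))) \<longlongrightarrow> 0) (at x)" by simp
  qed
  have "((\<lambda>y. L (kap y - E y (z y))) \<longlongrightarrow> L (kap x - 0)) (at x)"
    by (intro bounded_linear.tendsto[OF Lcont] tendsto_intros kap_tend E_tend)
  moreover have "L (kap x - 0) = z x"
    using zL[OF x] by (simp add: E_def)
  moreover have "\<forall>\<^sub>F y in at x. L (kap y - E y (z y)) = z y"
    using evT by (rule eventually_mono) (rule zL[symmetric])
  ultimately have "(z \<longlongrightarrow> z x) (at x)"
    using tendsto_cong by fastforce
  then have z_cont: "isCont z x" by (simp add: continuous_at)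
  have "(\<lambda>y. (z y \<bullet> j) * (B y j i - B x j i)) differentiable (at x)" for i j
  proof -
    have "((\<lambda>y. B y j i - B x j i) has_derivative (\<lambda>u. dd (\<lambda>y. B y j i) x u - 0)) (at x)"
      by (intro has_derivative_diff has_derivative_dd diff_B x has_derivative_const)
    from has_derivative_continuous_times_vanishing[OF this, of "\<lambda>y. z y \<bullet> j"] z_cont
    show ?thesis by (intro differentiableI) (auto intro: continuous_intros)
  qed
  then have "(\<lambda>y. E y (z y)) differentiable (at x)"
    unfolding E_def
    by (intro differentiable_sum differentiable_scaleR differentiable_const ballI finite_Basis)
  then have "(\<lambda>y. kap y - E y (z y)) differentiable (at x)"
    by (intro differentiable_diff kap_diff)
  then obtain D where "((\<lambda>y. kap y - E y (z y)) has_derivative D) (at x)"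
    unfolding differentiable_def by blast
  from bounded_linear.has_derivative[OF Lcont this]
  have "(z has_derivative (\<lambda>u. L (D u))) (at x)"
    by (rule has_derivative_transform_within_open[OF _ open_T x]) (rule zL[symmetric])
  then show ?thesis by (rule differentiableI)
qed

section \<open>The Levi-Civita connection\<close>

locale coordinate_metric =
  fixes T :: "'b::euclidean_space set" and G :: "'b metric"
  assumes open_dom: "open T"
    and ip: "x \<in> T \<Longrightarrow> inner_product (G x)"
    and smooth_G: "smooth_on (\<lambda>x. G x u v) T"
begin

sublocale bilinear_field T G
  using open_dom ip smooth_G
  by unfold_locales (auto simp: inner_product_def intro: smooth_on_differentiable[where S=T])

lemma inner_prod_at: "x \<in> T \<Longrightarrow> inner_prod (G x)"
  by unfold_locales (rule ip)

lemma dd_G_swap: "x \<in> T \<Longrightarrow> dd (\<lambda>y. G y u v) x w = dd (\<lambda>y. G y v u) x w"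
  using dd_cong[OF open_dom, of x "\<lambda>y. G y u v" "\<lambda>y. G y v u"] inner_prod.sym[OF inner_prod_at] by auto

definition koszul :: "'b \<Rightarrow> 'b \<Rightarrow> 'b \<Rightarrow> 'b \<Rightarrow> real" where
  "koszul x u v w = (dd (\<lambda>y. G y v w) x u + dd (\<lambda>y. G y u w) x v - dd (\<lambda>y. G y u v) x w) / 2"

lemma linear_koszul:
  assumes "x \<in> T"
  shows "linear (koszul x u v)" "linear (\<lambda>u. koszul x u v w)"
proof -
  have 1: "linear (dd (\<lambda>y. G y a b) x)" for a b
    by (rule linear_frechet_derivative[OF diff_B[OF assms]])
  have 2: "linear (\<lambda>b. dd (\<lambda>y. G y a b) x c)" "linear (\<lambda>a. dd (\<lambda>y. G y a b) x c)" for a b c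
    using dd_bilinear[OF assms] by (simp_all add: bilinear_def)
  show "linear (koszul x u v)" "linear (\<lambda>u. koszul x u v w)"
    unfolding koszul_def
    by (rule linearI; simp add: linear_add[OF 1] linear_cmul[OF 1] linear_add[OF 2(1)]
        linear_add[OF 2(2)] linear_cmul[OF 2(1)] linear_cmul[OF 2(2)] field_simps)+
qed

lemma christoffel_koszul:
  assumes "x \<in> T"
  shows "G x (christoffel G x u v) w = koszul x u v w"
proof -
  have "\<exists>!z. \<forall>w. G x z w = koszul x u v w"
    by (rule inner_prod.riesz[OF inner_prod_at[OF assms] linear_koszul(1)[OF assms]])
  from theI'[OF this] show ?thesis
    unfolding christoffel_def koszul_def by blast
qed

lemma christoffel_eqI:
  assumes "x \<in> T" "\<And>w. G x z w = koszul x u v w"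
  shows "z = christoffel G x u v"
  by (rule inner_prod.eqI[OF inner_prod_at[OF assms(1)]]) (simp add: assms christoffel_koszul)

lemma christoffel_sym: "x \<in> T \<Longrightarrow> christoffel G x u v = christoffel G x v u"
  by (rule christoffel_eqI) (simp_all add: christoffel_koszul koszul_def dd_G_swap[of x u v] add.commute)

lemma christoffel_bilinear:
  assumes "x \<in> T" shows "bilinear (christoffel G x)"
proof -
  interpret inner_prod "G x" by (rule inner_prod_at[OF assms])
  have "linear (\<lambda>u. christoffel G x u v)" for v
    by (rule linearI; rule eqI)
      (simp_all add: alg christoffel_koszul assms linear_add[OF linear_koszul(2)] linear_cmul[OF linear_koszul(2)])
  then show ?thesis
    unfolding bilinear_def by (simp add: christoffel_sym[OF assms])
qed

text \<open>Adding the Koszul formulas for \<open>\<langle>\<nabla>\<^sub>u v, w\<rangle>\<close> and \<open>\<langle>\<nabla>\<^sub>u w, v\<rangle>\<close> cancels all but one derivative.\<close>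

lemma metric_compatible:
  assumes "x \<in> T"
  shows "dd (\<lambda>y. G y v w) x u = G x (christoffel G x u v) w + G x v (christoffel G x u w)"
  unfolding inner_prod.sym[OF inner_prod_at[OF assms], of v] christoffel_koszul[OF assms] koszul_def
  using dd_G_swap[OF assms] by (simp add: field_simps)

text \<open>The Koszul formula is an equation of the kind solved by the Riesz representation.\<close>

lemma christoffel_differentiable:
  assumes "x \<in> T" shows "(\<lambda>y. christoffel G y u v) differentiable (at x)"
proof (rule riesz_differentiable[OF _ ip assms, where k="\<lambda>y. koszul y u v"])
  show "bilinear_field T G" by unfold_locales
  have "(\<lambda>y. dd (\<lambda>y. G y a b) y c) differentiable (at x)" for a b c
    by (rule smooth_on_differentiable[OF smooth_on_dd[OF smooth_G] assms])
  then show "(\<lambda>y. koszul y u v w) differentiable (at x)" for w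
    unfolding koszul_def by (intro differentiable_divide differentiable_add differentiable_diff) auto
qed (simp_all add: christoffel_koszul)

sublocale chr: bilinear_field T "christoffel G"
  by unfold_locales (simp_all add: open_dom christoffel_bilinear christoffel_differentiable)

section \<open>The curvature tensor\<close>

lemma curvature_christoffel:
  "curvature G x u v w = dd (\<lambda>y. christoffel G y v w) x u - dd (\<lambda>y. christoffel G y u w) x v
     + christoffel G x u (christoffel G x v w) - christoffel G x v (christoffel G x u w)"
  unfolding curvature_def cov_deriv_def by simp

lemma curvature_linear:
  assumes "x \<in> T"
  shows "linear (\<lambda>u. curvature G x u v w)" "linear (\<lambda>v. curvature G x u v w)" "linear (curvature G x u v)"
proof -
  note b = chr.dd_bilinear[OF assms] christoffel_bilinear[OF assms]
  have 1: "linear (dd (\<lambda>y. christoffel G y a b) x)" for a b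
    by (rule linear_frechet_derivative[OF christoffel_differentiable[OF assms]])
  show "linear (\<lambda>u. curvature G x u v w)" "linear (\<lambda>v. curvature G x u v w)" "linear (curvature G x u v)"
    unfolding curvature_christoffel
    by (rule linearI; simp add: linear_add[OF 1] linear_cmul[OF 1] b[THEN bilinear_ladd] b[THEN bilinear_radd]
      b[THEN bilinear_lmul] b[THEN bilinear_rmul] algebra_simps)+
qed

lemma curvature_swap: "curvature G x u v w = - curvature G x v u w"
  unfolding curvature_christoffel by simp

lemma bianchi:
  assumes "x \<in> T"
  shows "curvature G x u v w + curvature G x v w u + curvature G x w u v = 0"
proof -
  have 1: "dd (\<lambda>y. christoffel G y a b) x c = dd (\<lambda>y. christoffel G y b a) x c" for a b c
    by (rule fun_cong[OF dd_cong[OF open_dom assms christoffel_sym]])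
  show ?thesis
    unfolding curvature_christoffel
    using 1[of u v] 1[of v w] 1[of u w] christoffel_sym[OF assms, of u v]
      christoffel_sym[OF assms, of v w] christoffel_sym[OF assms, of u w] by simp
qed

lemma dd_metric_along:
  assumes x: "x \<in> S" and S: "open S" "\<And>y. y \<in> S \<Longrightarrow> F y \<in> T"
    and F: "F differentiable (at x)" and Y: "Y differentiable (at x)" and Z: "Z differentiable (at x)"
  shows "dd (\<lambda>x. G (F x) (Y x) (Z x)) x u
    = G (F x) (cov_deriv_along G F Y x u) (Z x) + G (F x) (Y x) (cov_deriv_along G F Z x u)"
proof -
  have Fx: "F x \<in> T" using x S by auto
  show ?thesis
    by (subst dd_eqI[OF has_derivative_along[OF x S has_derivative_dd[OF F] has_derivative_dd[OF Y]
      has_derivative_dd[OF Z]]])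
      (simp_all add: metric_compatible[OF Fx] cov_deriv_along_def bilinear_ladd[OF bilin[OF Fx]]
        bilinear_radd[OF bilin[OF Fx]])
qed

text \<open>Applying metric compatibility twice expresses the second derivative of \<open>\<langle>a, b\<rangle>\<close>; its symmetry
  in the two directions is the claim.\<close>

lemma curvature_skew:
  assumes x: "x \<in> T"
  shows "G x (curvature G x u v a) b = - G x a (curvature G x u v b)"
proof -
  let ?C = "christoffel G"
  interpret inner_prod "G x" by (rule inner_prod_at[OF x])
  (* The covariant derivative along the identity map is the ordinary one. *)
  have id: "(\<lambda>y. y) differentiable (at x)" by simp
  have D: "cov_deriv_along G (\<lambda>y. y) (\<lambda>y. ?C y s a) x t = dd (\<lambda>y. ?C y s a) x t + ?C x t (?C x s a)"
    "cov_deriv_along G (\<lambda>y. y) (\<lambda>y. a) x t = ?C x t a" for s t a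
    by (simp_all add: cov_deriv_along_def)
  have *: "dd (\<lambda>y. dd (\<lambda>y. G y a b) y s) x t
     = G x (dd (\<lambda>y. ?C y s a) x t + ?C x t (?C x s a)) b + G x (?C x s a) (?C x t b)
      + (G x (?C x t a) (?C x s b) + G x a (dd (\<lambda>y. ?C y s b) x t + ?C x t (?C x s b)))" for s t
  proof -
    have "dd (\<lambda>y. dd (\<lambda>y. G y a b) y s) x t = dd (\<lambda>y. G y (?C y s a) b + G y a (?C y s b)) x t"
      by (subst dd_cong[OF open_dom x]) (auto simp: metric_compatible)
    also have "\<dots> = dd (\<lambda>y. G y (?C y s a) b) x t + dd (\<lambda>y. G y a (?C y s b)) x t"
      by (intro dd_eqI has_derivative_add has_derivative_dd)
        (intro differentiableI[OF has_derivative_along[OF x open_dom _ has_derivative_dd has_derivative_dd has_derivative_dd]]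
           id christoffel_differentiable x differentiable_const; assumption)+
    also have "\<dots> = G x (dd (\<lambda>y. ?C y s a) x t + ?C x t (?C x s a)) b + G x (?C x s a) (?C x t b)
      + (G x (?C x t a) (?C x s b) + G x a (dd (\<lambda>y. ?C y s b) x t + ?C x t (?C x s b)))"
      by (subst (1 2) dd_metric_along[OF x open_dom _ id])
        (simp_all add: christoffel_differentiable x D)
    finally show ?thesis .
  qed
  have "dd (\<lambda>y. dd (\<lambda>y. G y a b) y v) x u = dd (\<lambda>y. dd (\<lambda>y. G y a b) y u) x v"
    by (rule second_derivative_symmetric[OF smooth_G open_dom x])
  then show ?thesis
    unfolding * curvature_christoffel by (simp add: alg)
qed

end

section \<open>Covariant derivatives along a map\<close>

text \<open>The calculus of vector fields along a map, that is of maps \<open>Y\<close> with \<open>Y x\<close> tangent at \<open>F x\<close>. For the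
  hypersurface it is applied to the normal field and to the images of constant coordinate fields.\<close>

locale smooth_map_into = coordinate_metric T G
  for T :: "'b::euclidean_space set" and G +
  fixes S :: "'e::euclidean_space set" and F :: "'e \<Rightarrow> 'b"
  assumes open_S: "open S" and F_in: "x \<in> S \<Longrightarrow> F x \<in> T" and smooth_F: "smooth_on F S"
begin

abbreviation cov :: "('e \<Rightarrow> 'b) \<Rightarrow> 'e \<Rightarrow> 'e \<Rightarrow> 'b" where
  "cov \<equiv> cov_deriv_along G F"

lemma F_diff: "x \<in> S \<Longrightarrow> F differentiable (at x)"
  by (rule smooth_on_differentiable[OF smooth_F])

lemma product_rule:
  assumes "x \<in> S" "Y differentiable (at x)" "Z differentiable (at x)"
  shows "dd (\<lambda>x. G (F x) (Y x) (Z x)) x u = G (F x) (cov Y x u) (Z x) + G (F x) (Y x) (cov Z x u)"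
  by (rule dd_metric_along[OF assms(1) open_S F_in F_diff[OF assms(1)] assms(2,3)])

lemma torsion_free:
  assumes "x \<in> S"
  shows "cov (\<lambda>y. dd F y v) x u = cov (\<lambda>y. dd F y u) x v"
  unfolding cov_deriv_along_def
  by (simp add: second_derivative_symmetric[OF smooth_F open_S assms] christoffel_sym[OF F_in[OF assms]])

lemma has_derivative_cov:
  assumes x: "x \<in> S" and Y: "smooth_on Y S"
  shows "((\<lambda>y. cov Y y v) has_derivative (\<lambda>u. dd (\<lambda>y. dd Y y v) x u
      + (dd (\<lambda>z. christoffel G z (dd F x v) (Y x)) (F x) (dd F x u)
         + christoffel G (F x) (dd (\<lambda>y. dd F y v) x u) (Y x)
         + christoffel G (F x) (dd F x v) (dd Y x u)))) (at x)"
  unfolding cov_deriv_along_def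
  by (intro has_derivative_add has_derivative_dd chr.has_derivative_along[OF x open_S F_in]
      smooth_on_differentiable[OF _ x] smooth_on_dd smooth_F Y)

lemma cov_differentiable: "x \<in> S \<Longrightarrow> smooth_on Y S \<Longrightarrow> (\<lambda>y. cov Y y v) differentiable (at x)"
  by (rule differentiableI[OF has_derivative_cov])

text \<open>All terms of the second covariant derivative that are not part of the curvature are symmetric in
  \<open>u\<close> and \<open>v\<close>, because second derivatives and Christoffel symbols are.\<close>

lemma cov_commutator:
  assumes x: "x \<in> S" and Y: "smooth_on Y S"
  shows "cov (\<lambda>y. cov Y y v) x u - cov (\<lambda>y. cov Y y u) x v
    = curvature G (F x) (dd F x u) (dd F x v) (Y x)"
proof -
  note rad = bilinear_radd[OF christoffel_bilinear[OF F_in[OF x]]]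
  have *: "cov (\<lambda>y. cov Y y v) x u = dd (\<lambda>y. dd Y y v) x u
      + (dd (\<lambda>z. christoffel G z (dd F x v) (Y x)) (F x) (dd F x u)
         + christoffel G (F x) (dd (\<lambda>y. dd F y v) x u) (Y x)
         + christoffel G (F x) (dd F x v) (dd Y x u))
      + christoffel G (F x) (dd F x u) (dd Y x v + christoffel G (F x) (dd F x v) (Y x))" for u v
    unfolding cov_deriv_along_def[of G F "\<lambda>y. cov Y y v"] dd_eqI[OF has_derivative_cov[OF x Y]]
    by (simp add: cov_deriv_along_def)
  show ?thesis
    unfolding * curvature_christoffel rad
    using second_derivative_symmetric[OF Y open_S x, of u v]
      second_derivative_symmetric[OF smooth_F open_S x, of u v] by simp
qed

end

section \<open>The equations of Gauss and Weingarten\<close>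

locale hypersurface = smooth_map_into T G S F + M: coordinate_metric S h
  for T :: "'b::euclidean_space set" and G
    and S :: "'e::euclidean_space set" and F :: "'e \<Rightarrow> 'b" and h +
  fixes N :: "'e \<Rightarrow> 'b"
  assumes induced: "x \<in> S \<Longrightarrow> h x u v = G (F x) (dd F x u) (dd F x v)"
    and codim: "DIM('e) + 1 = DIM('b)"
    and smooth_N: "smooth_on N S"
    and unit_N: "x \<in> S \<Longrightarrow> G (F x) (N x) (N x) = 1"
    and normal_N: "x \<in> S \<Longrightarrow> G (F x) (N x) (dd F x u) = 0"
begin

text \<open>The map \<open>(z, t) \<mapsto> dF z + t N\<close> is injective, hence surjective because the codimension is one.\<close>

lemma tangent_normal_decomposition:
  assumes x: "x \<in> S"
  obtains z t where "a = dd F x z + t *\<^sub>R N x"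
proof -
  interpret g: inner_prod "G (F x)" by (rule inner_prod_at[OF F_in[OF x]])
  interpret hh: inner_prod "h x" by (rule M.inner_prod_at[OF x])
  have lin: "linear (dd F x)" by (rule linear_frechet_derivative[OF F_diff[OF x]])
  define L where "L p = dd F x (fst p) + snd p *\<^sub>R N x" for p :: "'e \<times> real"
  have L: "linear L"
    by (rule linearI) (simp_all add: L_def linear_add[OF lin] linear_cmul[OF lin] algebra_simps)
  have "p = 0" if "L p = 0" for p
  proof -
    have "G (F x) (N x) (L p) = snd p"
      by (simp add: L_def g.alg unit_N[OF x] normal_N[OF x])
    then have "snd p = 0" using that by (simp add: g.alg)
    then have "h x (fst p) (fst p) = 0"
      using that by (simp add: L_def induced[OF x] g.alg)
    then show ?thesis using \<open>snd p = 0\<close> by (simp add: hh.eq_0_iff prod_eq_iff)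
  qed
  then have "inj L" using linear_injective_0[OF L] by blast
  then have "dim (range L) = dim (UNIV :: ('e \<times> real) set)"
    by (intro dim_image_eq[OF L]) auto
  then have "dim (range L) = DIM('b)" using codim by simp
  then have "range L = UNIV"
    using dim_eq_full[of "range L"] span_eq_iff[of "range L"] linear_subspace_image[OF L subspace_UNIV] by simp
  then obtain p where "a = L p" by blast
  then show ?thesis using that by (simp add: L_def)
qed

lemma ambient_eqI:
  assumes x: "x \<in> S" and "\<And>z. G (F x) a (dd F x z) = G (F x) b (dd F x z)"
    and "G (F x) a (N x) = G (F x) b (N x)"
  shows "a = b"
proof -
  interpret g: inner_prod "G (F x)" by (rule inner_prod_at[OF F_in[OF x]])
  show ?thesis
  proof (rule g.eqI)
    fix w
    obtain z t where "w = dd F x z + t *\<^sub>R N x"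
      by (rule tangent_normal_decomposition[OF x])
    then show "G (F x) a w = G (F x) b w" using assms by (simp add: g.alg)
  qed
qed

lemma dF_inj:
  assumes x: "x \<in> S" and "dd F x a = dd F x b"
  shows "a = b"
  by (rule inner_prod.eqI[OF M.inner_prod_at[OF x]]) (simp add: induced[OF x] assms(2))

text \<open>Identifies the definite description in \<open>tangential_J\<close>, for an arbitrary ambient vector \<open>a\<close> in place
  of \<open>J (dF u)\<close>.\<close>

lemma tangential_part:
  assumes x: "x \<in> S"
  shows "h x (THE z. \<exists>\<nu>. (\<forall>w. G (F x) \<nu> (dd F x w) = 0) \<and> a = dd F x z + \<nu>) w = G (F x) a (dd F x w)"
proof -
  interpret g: inner_prod "G (F x)" by (rule inner_prod_at[OF F_in[OF x]])
  interpret hh: inner_prod "h x" by (rule M.inner_prod_at[OF x])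
  let ?P = "\<lambda>z. \<exists>\<nu>. (\<forall>w. G (F x) \<nu> (dd F x w) = 0) \<and> a = dd F x z + \<nu>"
  have P: "h x z w = G (F x) a (dd F x w)" if "?P z" for z w
    using that by (auto simp: induced[OF x] g.alg)
  obtain z t where "a = dd F x z + t *\<^sub>R N x"
    by (rule tangent_normal_decomposition[OF x])
  then have "?P z"
    by (intro exI[of _ "t *\<^sub>R N x"]) (simp add: g.alg normal_N[OF x])
  moreover have "z' = z" if "?P z'" for z'
    by (rule hh.eqI) (simp add: P[OF that] P[OF \<open>?P z\<close>])
  ultimately have "(THE z. ?P z) = z" by (rule the_equality)
  then show ?thesis using P[OF \<open>?P z\<close>] by simp
qed

abbreviation dF :: "'e \<Rightarrow> 'e \<Rightarrow> 'b" where
  "dF w \<equiv> \<lambda>y. dd F y w"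

lemma dF_differentiable: "x \<in> S \<Longrightarrow> dF w differentiable (at x)"
  by (rule smooth_on_differentiable[OF smooth_on_dd[OF smooth_F]])

text \<open>The tangential part of the ambient connection is torsion free and compatible with the induced
  metric; these two properties imply the Koszul formula, so it is the Levi-Civita connection of the
  hypersurface.\<close>

lemma tangential_connection:
  assumes x: "x \<in> S"
  shows "G (F x) (cov (dF w) x v) (dF z x) = h x (christoffel h x v w) z"
proof -
  interpret g: inner_prod "G (F x)" by (rule inner_prod_at[OF F_in[OF x]])
  define t where "t v w z = G (F x) (cov (dF w) x v) (dF z x)" for v w z
  have 1: "dd (\<lambda>y. h y w z) x v = t v w z + t v z w" for v w z
  proof -
    have "dd (\<lambda>y. h y w z) x v = dd (\<lambda>y. G (F y) (dF w y) (dF z y)) x v"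
      by (subst dd_cong[OF open_S x]) (auto simp: induced)
    then show ?thesis
      by (simp add: product_rule[OF x dF_differentiable[OF x] dF_differentiable[OF x]] t_def
          g.sym[of "dF w x"])
  qed
  have 2: "t v w z = t w v z" for v w z
    unfolding t_def using torsion_free[OF x] by simp
  have "M.koszul x v w z = t v w z"
    unfolding M.koszul_def 1 using 2[of v w z] 2[of v z w] 2[of w z v] by simp
  then show ?thesis
    by (simp add: M.christoffel_koszul[OF x] t_def)
qed

definition second_form :: "'e \<Rightarrow> 'e \<Rightarrow> 'e \<Rightarrow> real" where
  "second_form x v w = G (F x) (cov (dF w) x v) (N x)"

lemma second_form_sym: "x \<in> S \<Longrightarrow> second_form x v w = second_form x w v"
  unfolding second_form_def by (simp add: torsion_free[of x v w])

lemma gauss_formula: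
  assumes x: "x \<in> S"
  shows "cov (dF w) x v = dd F x (christoffel h x v w) + second_form x v w *\<^sub>R N x"
proof -
  interpret g: inner_prod "G (F x)" by (rule inner_prod_at[OF F_in[OF x]])
  show ?thesis
    by (rule ambient_eqI[OF x])
      (simp_all add: tangential_connection[OF x] induced[OF x] g.alg normal_N[OF x] unit_N[OF x]
        g.sym[of "dd F x _" "N x"] second_form_def)
qed

text \<open>The commutator of covariant derivatives along the immersion, applied to \<open>dF w\<close>, is the ambient
  curvature. Its inner product with \<open>dF z\<close> is computed by differentiating
  \<open>\<langle>D\<^sub>v dF w, dF z\<rangle> = \<langle>\<nabla>\<^sub>v w, z\<rangle>\<close>, which avoids differentiating the normal field or the second
  fundamental form.\<close>

lemma gauss_equation:
  assumes x: "x \<in> S"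
  shows "h x (curvature h x u v w) z
    = G (F x) (curvature G (F x) (dF u x) (dF v x) (dF w x)) (dF z x)
      + second_form x v w * second_form x u z - second_form x u w * second_form x v z"
proof -
  let ?C = "christoffel h" and ?b = "second_form x"
  interpret g: inner_prod "G (F x)" by (rule inner_prod_at[OF F_in[OF x]])
  interpret hh: inner_prod "h x" by (rule M.inner_prod_at[OF x])
  have smooth_dF: "smooth_on (dF w) S" for w by (rule smooth_on_dd[OF smooth_F])
  have *: "G (F x) (cov (\<lambda>y. cov (dF w) y v) x u) (dF z x)
     = h x (dd (\<lambda>y. ?C y v w) x u + ?C x u (?C x v w)) z - ?b v w * ?b u z" for u v
  proof -
    have "G (F x) (cov (\<lambda>y. cov (dF w) y v) x u) (dF z x) + G (F x) (cov (dF w) x v) (cov (dF z) x u)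
      = dd (\<lambda>y. G (F y) (cov (dF w) y v) (dF z y)) x u"
      by (rule product_rule[OF x cov_differentiable[OF x smooth_dF] dF_differentiable[OF x], symmetric])
    also have "\<dots> = dd (\<lambda>y. h y (?C y v w) z) x u"
      by (rule fun_cong[OF dd_cong[OF open_S x]]) (rule tangential_connection)
    also have "\<dots> = h x (dd (\<lambda>y. ?C y v w) x u + ?C x u (?C x v w)) z + h x (?C x v w) (?C x u z)"
      using M.dd_metric_along[OF x open_S _ _ M.christoffel_differentiable[OF x], of "\<lambda>y. y" "\<lambda>y. z" v w u]
      by (simp add: cov_deriv_along_def)
    also have "h x (?C x v w) (?C x u z) = G (F x) (cov (dF w) x v) (cov (dF z) x u) - ?b v w * ?b u z"
      by (simp add: gauss_formula[OF x] g.alg unit_N[OF x] normal_N[OF x] g.sym[of "dd F x _" "N x"]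
          induced[OF x])
    finally show ?thesis by simp
  qed
  have "G (F x) (curvature G (F x) (dF u x) (dF v x) (dF w x)) (dF z x)
     = G (F x) (cov (\<lambda>y. cov (dF w) y v) x u - cov (\<lambda>y. cov (dF w) y u) x v) (dF z x)"
    by (simp only: cov_commutator[OF x smooth_dF])
  also have "\<dots> = h x (curvature h x u v w) z - ?b v w * ?b u z + ?b u w * ?b v z"
    unfolding g.alg * M.curvature_christoffel by (simp add: hh.alg)
  finally show ?thesis by simp
qed

text \<open>The Weingarten equation. Differentiating \<open>\<langle>N, N\<rangle> = 1\<close> shows that \<open>D\<^sub>u N\<close> is tangent, so that the shape
  operator is well defined; differentiating \<open>\<langle>N, dF v\<rangle> = 0\<close> computes it.\<close>

lemma shape_operator_form:
  assumes x: "x \<in> S"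
  shows "h x (shape_operator G F N x u) v = second_form x u v"
proof -
  interpret g: inner_prod "G (F x)" by (rule inner_prod_at[OF F_in[OF x]])
  have Nd: "N differentiable (at x)" by (rule smooth_on_differentiable[OF smooth_N x])
  have "dd (\<lambda>y. G (F y) (N y) (N y)) x u = 0"
    using dd_cong[OF open_S x, of "\<lambda>y. G (F y) (N y) (N y)" "\<lambda>_. 1"] unit_N by simp
  then have 1: "G (F x) (cov N x u) (N x) = 0"
    by (simp add: product_rule[OF x Nd Nd] g.sym[of "N x"])
  have 2: "G (F x) (cov N x u) (dF v x) = - second_form x u v" for v
  proof -
    have "dd (\<lambda>y. G (F y) (N y) (dF v y)) x u = 0"
      using dd_cong[OF open_S x, of "\<lambda>y. G (F y) (N y) (dF v y)" "\<lambda>_. 0"] normal_N by simp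
    then show ?thesis
      by (simp add: product_rule[OF x Nd dF_differentiable[OF x]] second_form_def g.sym[of "N x"])
  qed
  obtain a t where at: "- cov N x u = dd F x a + t *\<^sub>R N x"
    by (rule tangent_normal_decomposition[OF x])
  have "G (F x) (- cov N x u) (N x) = t"
    unfolding at by (simp add: g.alg unit_N[OF x] normal_N[OF x] g.sym[of "dd F x _" "N x"])
  then have "t = 0" using 1 by (simp add: g.alg)
  then have a: "dd F x a = - cov N x u" using at by simp
  have "shape_operator G F N x u = a"
    unfolding shape_operator_def
    using a by (intro the_equality) (auto intro: dF_inj[OF x])
  then show ?thesis using 2[of v] by (simp add: induced[OF x] a g.alg)
qed

lemma linear_shape_operator:
  assumes x: "x \<in> S" shows "linear (shape_operator G F N x)"
proof -
  interpret hh: inner_prod "h x" by (rule M.inner_prod_at[OF x])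
  interpret g: inner_prod "G (F x)" by (rule inner_prod_at[OF F_in[OF x]])
  have lin: "linear (dd Y x)" if "smooth_on Y S" for Y :: "'e \<Rightarrow> 'b"
    by (rule linear_frechet_derivative[OF smooth_on_differentiable[OF that x]])
  note lins = lin[OF smooth_F] lin[OF smooth_on_dd[OF smooth_F]]
  note bil = christoffel_bilinear[OF F_in[OF x]]
  show ?thesis
    by (rule linearI; rule hh.eqI)
      (simp_all add: hh.alg shape_operator_form[OF x] second_form_def cov_deriv_along_def
        lins[THEN linear_add] lins[THEN linear_cmul] bilinear_ladd[OF bil] bilinear_lmul[OF bil] g.alg
        algebra_simps)
qed

lemma shape_operator_sym:
  "x \<in> S \<Longrightarrow> h x (shape_operator G F N x u) v = h x u (shape_operator G F N x v)"
  by (metis shape_operator_form second_form_sym inner_prod.sym M.inner_prod_at)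

end

section \<open>Constant holomorphic sectional curvature\<close>

text \<open>Milnor's octahedron argument: four instances of the Bianchi identity, reduced by the two skew
  symmetries to six unknowns, imply this equality.\<close>

lemma pair_symmetry:
  fixes Q :: "'v \<Rightarrow> 'v \<Rightarrow> 'v \<Rightarrow> 'v \<Rightarrow> real"
  assumes "\<And>u v w z. Q u v w z = - Q v u w z" "\<And>u v w z. Q u v w z = - Q u v z w"
    and "\<And>u v w z. Q u v w z + Q v w u z + Q w u v z = 0"
  shows "Q u v w z = Q w z u v"
  using assms(3)[of u v w z] assms(3)[of v w z u] assms(3)[of w z u v] assms(3)[of z u v w]
    assms(1)[of z v w u] assms(1)[of z u w v] assms(1)[of u w z v] assms(1)[of z u v w]
    assms(2)[of v w z u] assms(2)[of w z v u] assms(2)[of u z w v] assms(2)[of w u z v]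
    assms(2)[of u v z w] assms(2)[of v z u w]
  by linarith

text \<open>The quartic form \<open>Q(u, Ju, Ju, u)\<close> is known. Its polarization of degree two both in \<open>u\<close> and in \<open>v\<close>,
  together with the Bianchi identity, gives one linear relation (\<open>key\<close>) between \<open>Q(u, v, u, v)\<close> and
  \<open>Q(u, Jv, u, Jv)\<close>; the same relation with \<open>Jv\<close> in place of \<open>v\<close> is a second one, and the two are
  independent.\<close>

lemma constant_holomorphic_curvature:
  fixes Q :: "'v::euclidean_space \<Rightarrow> 'v \<Rightarrow> 'v \<Rightarrow> 'v \<Rightarrow> real" and J :: "'v \<Rightarrow> 'v"
  assumes b: "inner_product b"
    and J: "linear J" "\<And>v. J (J v) = - v" "\<And>u v. b (J u) (J v) = b u v"
    and lin: "\<And>v w z. linear (\<lambda>u. Q u v w z)" "\<And>u w z. linear (\<lambda>v. Q u v w z)"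
      "\<And>u v z. linear (\<lambda>w. Q u v w z)" "\<And>u v w. linear (\<lambda>z. Q u v w z)"
    and skew12: "\<And>u v w z. Q u v w z = - Q v u w z" and skew34: "\<And>u v w z. Q u v w z = - Q u v z w"
    and bianchi: "\<And>u v w z. Q u v w z + Q v w u z + Q w u v z = 0"
    and QJ: "\<And>u v w z. Q u v (J w) (J z) = Q u v w z"
    and hol: "\<And>u. Q u (J u) (J u) u = k * (b u u)\<^sup>2"
  shows "Q u v v u = k / 4 * (b u u * b v v - (b u v)\<^sup>2 + 3 * (b u (J v))\<^sup>2)"
proof -
  interpret inner_prod b by unfold_locales (rule b)
  have pair: "Q u v w z = Q w z u v" for u v w z
    by (rule pair_symmetry[OF skew12 skew34 bianchi])
  have QJ12: "Q (J u) (J v) w z = Q u v w z" for u v w z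
    using QJ pair by metis
  (* The twist by J makes Q symmetric in each pair of arguments, so that few terms of the
     polarization are distinct. *)
  define P where "P x y z w = Q x (J y) z (J w)" for x y z w
  have P12: "P x y z w = P y x z w" for x y z w
    using QJ12[of x "J y" z "J w"] skew12[of "J x" y z "J w"] linear_neg[OF lin(2)]
    by (simp add: P_def J)
  have P34: "P x y z w = P x y w z" for x y z w
    using P12[of z w x y] by (simp add: P_def pair[of x])
  have Ppair: "P x y z w = P z w x y" for x y z w
    by (simp add: P_def pair[of x])
  have add: "P (x + x') y z w = P x y z w + P x' y z w" "P x (y + y') z w = P x y z w + P x y' z w"
    "P x y (z + z') w = P x y z w + P x y z' w" "P x y z (w + w') = P x y z w + P x y z w'"
    for x x' y y' z z' w w'
    by (simp_all add: P_def lin[THEN linear_add] linear_add[OF J(1)])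
  have diff: "P (x - x') y z w = P x y z w - P x' y z w" "P x (y - y') z w = P x y z w - P x y' z w"
    "P x y (z - z') w = P x y z w - P x y z' w" "P x y z (w - w') = P x y z w - P x y z w'"
    for x x' y y' z z' w w'
    by (simp_all add: P_def lin[THEN linear_diff] linear_diff[OF J(1)])
  have q: "P u u u u = - (k * (b u u)\<^sup>2)" for u
    using hol[of u] skew34[of u "J u" u "J u"] by (simp add: P_def)
  have key: "3 * Q u (J v) u (J v) + Q u v u v = - k * (b u u * b v v + 2 * (b u v)\<^sup>2)" for u v
  proof -
    (* Adding the values at u + v and u - v removes the terms of odd degree in v. *)
    have "P (u + v) (u + v) (u + v) (u + v) + P (u - v) (u - v) (u - v) (u - v)
      = 2 * P u u u u + 2 * P v v v v + 4 * P u u v v + 8 * P u v u v"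
      unfolding add diff
      using P12[of v u] P34[of _ _ v u] Ppair[of v v u u] by simp
    then have "4 * P u u v v + 8 * P u v u v
      = - k * ((b (u + v) (u + v))\<^sup>2 + (b (u - v) (u - v))\<^sup>2 - 2 * (b u u)\<^sup>2 - 2 * (b v v)\<^sup>2)"
      unfolding q by (simp add: algebra_simps)
    also have "\<dots> = - k * (4 * (b u u * b v v) + 8 * (b u v)\<^sup>2)"
      unfolding alg sym[of v u] by (simp add: algebra_simps power2_eq_square)
    finally have 1: "P u u v v + 2 * P u v u v = - k * (b u u * b v v + 2 * (b u v)\<^sup>2)"
      by (simp add: algebra_simps)
    have "Q (J u) v u (J v) = - P u v u v"
      using skew12[of "J u" v u "J v"] P12[of v u u v] by (simp add: P_def)
    moreover have "Q v u (J u) (J v) = - Q u v u v"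
      using skew12[of v u u v] by (simp add: QJ)
    ultimately have "P u u v v = P u v u v + Q u v u v"
      using bianchi[of u "J u" v "J v"] by (simp add: P_def)
    then show ?thesis using 1 by (simp add: P_def)
  qed
  have "Q u (J (J v)) u (J (J v)) = Q u v u v"
    by (simp add: J(2) linear_neg[OF lin(2)] linear_neg[OF lin(4)])
  moreover have "b (J v) (J v) = b v v" by (rule J(3))
  ultimately have "3 * Q u v u v + Q u (J v) u (J v) = - k * (b u u * b v v + 2 * (b u (J v))\<^sup>2)"
    using key[of u "J v"] by simp
  then have "8 * Q u v u v = - k * (2 * (b u u * b v v) + 6 * (b u (J v))\<^sup>2 - 2 * (b u v)\<^sup>2)"
    using key[of u v] by (simp add: algebra_simps)
  moreover have "Q u v v u = - Q u v u v" by (rule skew34)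
  ultimately show ?thesis by (simp add: algebra_simps)
qed

lemma linear_Jc: "linear Jc"
  by (rule linearI) (simp_all add: Jc_def vec_eq_iff algebra_simps)

lemma Jc_Jc: "Jc (Jc v) = - v"
  by (simp add: Jc_def vec_eq_iff)

text \<open>A holomorphic coordinate domain of a Kaehler manifold. On constant coordinate fields \<open>\<nabla>J = 0\<close> is a
  condition on the Christoffel symbols alone.\<close>

locale kaehler_chart = coordinate_metric T G
  for T :: "(complex ^ 'n) set" and G +
  assumes hermitian: "x \<in> T \<Longrightarrow> G x (Jc u) (Jc v) = G x u v"
    and J_parallel: "x \<in> T \<Longrightarrow> christoffel G x u (Jc v) = Jc (christoffel G x u v)"
begin

lemma curvature_Jc:
  assumes x: "x \<in> T"
  shows "curvature G x u v (Jc w) = Jc (curvature G x u v w)"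
proof -
  have "dd (\<lambda>y. christoffel G y a (Jc w)) x c = Jc (dd (\<lambda>y. christoffel G y a w) x c)" for a c
  proof -
    have "dd (\<lambda>y. christoffel G y a (Jc w)) x c = dd (\<lambda>y. Jc (christoffel G y a w)) x c"
      by (rule fun_cong[OF dd_cong[OF open_T x]]) (rule J_parallel)
    also have "\<dots> = Jc (dd (\<lambda>y. christoffel G y a w) x c)"
      by (rule dd_eqI[OF bounded_linear.has_derivative[OF linear_Jc[unfolded linear_conv_bounded_linear]
        has_derivative_dd[OF christoffel_differentiable[OF x]]]])
    finally show ?thesis .
  qed
  then show ?thesis
    unfolding curvature_christoffel
    by (simp add: J_parallel[OF x] linear_add[OF linear_Jc] linear_diff[OF linear_Jc])
qed

lemma constant_holomorphic_curvature_tensor: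
  assumes x: "x \<in> T" and hol: "\<And>u. u \<noteq> 0 \<Longrightarrow> sectional_curvature G x u (Jc u) = k"
  shows "G x (curvature G x u v v) u
    = k / 4 * (G x u u * G x v v - (G x u v)\<^sup>2 + 3 * (G x u (Jc v))\<^sup>2)"
proof (rule constant_holomorphic_curvature[where Q="\<lambda>u v w z. G x (curvature G x u v w) z" and J=Jc])
  interpret inner_prod "G x" by (rule inner_prod_at[OF x])
  note lc = curvature_linear[OF x]
  show "inner_product (G x)" by (rule ip[OF x])
  show "linear (\<lambda>u. G x (curvature G x u v w) z)" "linear (\<lambda>v. G x (curvature G x u v w) z)"
    "linear (\<lambda>w. G x (curvature G x u v w) z)" "linear (\<lambda>z. G x (curvature G x u v w) z)" for u v w z
    by (rule linearI; simp add: alg lc[THEN linear_add] lc[THEN linear_cmul])+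
  show "G x (curvature G x u v w) z = - G x (curvature G x v u w) z" for u v w z
    using curvature_swap[of x u v w] by (simp add: alg)
  show "G x (curvature G x u v w) z = - G x (curvature G x u v z) w" for u v w z
    using curvature_skew[OF x, of u v w z] by (simp add: sym)
  show "G x (curvature G x u v w) z + G x (curvature G x v w u) z + G x (curvature G x w u v) z = 0" for u v w z
    using bianchi[OF x, of u v w] alg by metis
  show "G x (curvature G x u v (Jc w)) (Jc z) = G x (curvature G x u v w) z" for u v w z
    by (simp add: curvature_Jc[OF x] hermitian[OF x])
  show "G x (curvature G x u (Jc u) (Jc u)) u = k * (G x u u)\<^sup>2" for u
  proof (cases "u = 0")
    case False
    have "G x u (Jc u) = - G x (Jc u) u"
      using hermitian[OF x, of u "Jc u"] by (simp add: Jc_Jc alg)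
    then have "G x u (Jc u) = 0" using sym[of u "Jc u"] by simp
    then show ?thesis
      using hol[OF False] pos[OF False]
      by (simp add: sectional_curvature_def hermitian[OF x] power2_eq_square field_simps)
  qed (simp add: alg)
qed (simp_all add: linear_Jc Jc_Jc hermitian[OF x])

end

section \<open>Orthonormal bases\<close>

context inner_prod
begin

definition orthonormal_upto :: "nat \<Rightarrow> (nat \<Rightarrow> 'e) \<Rightarrow> bool" where
  "orthonormal_upto k e \<longleftrightarrow> (\<forall>i\<in>{1..k}. \<forall>j\<in>{1..k}. b (e i) (e j) = (if i = j then 1 else 0))"

lemma sum_left: "finite I \<Longrightarrow> b (\<Sum>i\<in>I. f i) v = (\<Sum>i\<in>I. b (f i) v)"
  by (induction I rule: finite_induct) (simp_all add: alg)

lemma orthonormal_coefficient: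
  assumes "orthonormal_upto k e" "j \<in> {1..k}"
  shows "b (\<Sum>i=1..k. a i *\<^sub>R e i) (e j) = a j"
proof -
  have "b (\<Sum>i=1..k. a i *\<^sub>R e i) (e j) = (\<Sum>i=1..k. a i * b (e i) (e j))"
    by (simp add: sum_left alg)
  also have "\<dots> = (\<Sum>i=1..k. if i = j then a i else 0)"
    using assms by (intro sum.cong) (auto simp: orthonormal_upto_def)
  finally show ?thesis using assms(2) by simp
qed

text \<open>One step of the Gram-Schmidt process.\<close>

lemma orthonormal_extend:
  assumes e: "orthonormal_upto k e" and "k < DIM('e)"
  obtains v where "orthonormal_upto (Suc k) (e(Suc k := v))"
proof -
  have "dim (e ` {1..k}) \<le> k"
    using dim_le_card'[of "e ` {1..k}"] card_image_le[of "{1..k}" e] by simp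
  then have "span (e ` {1..k}) \<noteq> UNIV"
    using assms(2) dim_eq_full[of "e ` {1..k}"] by simp
  then obtain y where y: "y \<notin> span (e ` {1..k})" by blast
  define p where "p = (\<Sum>i=1..k. b y (e i) *\<^sub>R e i)"
  have "p \<in> span (e ` {1..k})"
    unfolding p_def by (intro span_sum span_scale span_base) auto
  then have "y - p \<noteq> 0" using y by auto
  then have pos': "b (y - p) (y - p) > 0" by (rule pos)
  define v where "v = (1 / sqrt (b (y - p) (y - p))) *\<^sub>R (y - p)"
  have "b p (e j) = b y (e j)" if "j \<in> {1..k}" for j
    unfolding p_def by (rule orthonormal_coefficient[OF e that])
  then have "b v (e j) = 0" if "j \<in> {1..k}" for j
    using that by (simp add: v_def alg)
  moreover from this have "b (e j) v = 0" if "j \<in> {1..k}" for j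
    using that sym[of v "e j"] by simp
  moreover have "b v v = 1"
    unfolding v_def bilinear_lmul[OF bil] bilinear_rmul[OF bil] using pos'
    by (simp add: field_simps flip: power2_eq_square)
  ultimately have "orthonormal_upto (Suc k) (e(Suc k := v))"
    using e unfolding orthonormal_upto_def
    by (auto simp: le_Suc_eq)
  then show ?thesis by (rule that)
qed

text \<open>Gram-Schmidt starting from \<open>X\<close> makes it the first basis vector; the order is then reversed.\<close>

lemma orthonormal_basis_with_last:
  assumes "b X X = 1"
  obtains e where "orthonormal_basis b e" "e DIM('e) = X"
proof -
  have "\<exists>e. orthonormal_upto k e \<and> e 1 = X" if "1 \<le> k" "k \<le> DIM('e)" for k
    using that
  proof (induction k rule: dec_induct)
    case base
    show ?case using assms by (intro exI[of _ "\<lambda>_. X"]) (auto simp: orthonormal_upto_def)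
  next
    case (step k)
    then obtain e where e: "orthonormal_upto k e" "e 1 = X" by auto
    obtain v where v: "orthonormal_upto (Suc k) (e(Suc k := v))"
      by (rule orthonormal_extend[OF e(1)]) (use step in auto)
    moreover have "(e(Suc k := v)) 1 = X" using e(2) step by simp
    ultimately show ?case by blast
  qed
  from this[of "DIM('e)"] obtain e where e: "orthonormal_upto DIM('e) e" "e 1 = X"
    using DIM_positive[where 'a='e] by auto
  have "orthonormal_basis b (\<lambda>i. e (DIM('e) + 1 - i))"
    unfolding orthonormal_basis_def
  proof (intro ballI)
    fix i j assume "i \<in> {1..DIM('e)}" "j \<in> {1..DIM('e)}"
    then have "DIM('e) + 1 - i = DIM('e) + 1 - j \<longleftrightarrow> i = j"
      "DIM('e) + 1 - i \<in> {1..DIM('e)}" "DIM('e) + 1 - j \<in> {1..DIM('e)}" by auto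
    then show "b (e (DIM('e) + 1 - i)) (e (DIM('e) + 1 - j)) = (if i = j then 1 else 0)"
      using e(1) unfolding orthonormal_upto_def by auto
  qed
  then show ?thesis using that[of "\<lambda>i. e (DIM('e) + 1 - i)"] e(2) by simp
qed

context
  fixes e :: "nat \<Rightarrow> 'e"
  assumes onb: "orthonormal_basis b e"
begin

lemma onb_upto: "orthonormal_upto DIM('e) e"
  using onb by (simp add: orthonormal_basis_def orthonormal_upto_def)

lemma onb_expand: "v = (\<Sum>j=1..DIM('e). b v (e j) *\<^sub>R e j)"
proof -
  note coeff = orthonormal_coefficient[OF onb_upto]
  define \<Phi> where "\<Phi> w = (\<Sum>j=1..DIM('e). b w (e j) *\<^sub>R e j)" for w
  have inj: "inj_on e {1..DIM('e)}"
    using onb unfolding orthonormal_basis_def by (intro inj_onI) (metis zero_neq_one)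
  have "independent (e ` {1..DIM('e)})"
  proof -
    have "b u u = 1 \<and> (\<forall>w\<in>e ` {1..DIM('e)}. w \<noteq> u \<longrightarrow> b w u = 0)" if "u \<in> e ` {1..DIM('e)}" for u
      using that onb unfolding orthonormal_basis_def by auto
    then have 1: "a u = 0" if "(\<Sum>w\<in>e ` {1..DIM('e)}. a w *\<^sub>R w) = 0" "u \<in> e ` {1..DIM('e)}" for a u
    proof -
      have "0 = b (\<Sum>w\<in>e ` {1..DIM('e)}. a w *\<^sub>R w) u" using that by (simp add: alg)
      also have "\<dots> = (\<Sum>w\<in>e ` {1..DIM('e)}. if w = u then a w else 0)"
        unfolding sum_left[OF finite_imageI[OF finite_atLeastAtMost]] alg
        using \<open>\<And>u. u \<in> e ` {1..DIM('e)} \<Longrightarrow> _\<close> that(2) by (intro sum.cong) auto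
      also have "\<dots> = a u" using that(2) by simp
      finally show ?thesis by simp
    qed
    show ?thesis
      unfolding independent_explicit using 1 by auto
  qed
  then have "span (e ` {1..DIM('e)}) = UNIV"
    using dim_eq_full[of "e ` {1..DIM('e)}"] dim_eq_card_independent[of "e ` {1..DIM('e)}"] card_image[OF inj]
    by simp
  moreover have "b (v - \<Phi> v) w = 0" if "w \<in> span (e ` {1..DIM('e)})" for w
  proof (rule linear_eq_0_on_span[OF _ _ that])
    show "linear (b (v - \<Phi> v))" using bil by (simp add: bilinear_def)
    show "b (v - \<Phi> v) w = 0" if "w \<in> e ` {1..DIM('e)}" for w
      using that coeff[of _ "\<lambda>j. b v (e j)"] by (auto simp: alg \<Phi>_def)
  qed
  ultimately have "v - \<Phi> v = 0"
    using eqI[of "v - \<Phi> v" 0] by (simp add: alg)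
  then show ?thesis by (simp add: \<Phi>_def)
qed

lemma onb_parseval: "b u v = (\<Sum>j=1..DIM('e). b u (e j) * b v (e j))"
proof -
  have "b u v = b (\<Sum>j=1..DIM('e). b u (e j) *\<^sub>R e j) v"
    by (rule arg_cong[where f="\<lambda>w. b w v", OF onb_expand])
  then show ?thesis by (simp add: sum_left alg sym[of v "e _"])
qed

lemma onb_trace:
  assumes L: "linear L"
  shows "Tr L = (\<Sum>j=1..DIM('e). b (L (e j)) (e j))"
proof -
  have "L i \<bullet> i = (\<Sum>j=1..DIM('e). (L (e j) \<bullet> i) * b i (e j))" for i
  proof -
    have "L i = L (\<Sum>j=1..DIM('e). b i (e j) *\<^sub>R e j)"
      by (rule arg_cong[where f=L, OF onb_expand])
    also have "\<dots> = (\<Sum>j=1..DIM('e). b i (e j) *\<^sub>R L (e j))"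
      by (simp add: linear_sum[OF L] linear_cmul[OF L])
    finally show ?thesis by (simp add: inner_sum_left mult.commute)
  qed
  then have "Tr L = (\<Sum>i\<in>Basis. \<Sum>j=1..DIM('e). (L (e j) \<bullet> i) * b i (e j))"
    unfolding Tr_def by simp
  also have "\<dots> = (\<Sum>j=1..DIM('e). \<Sum>i\<in>Basis. (L (e j) \<bullet> i) * b i (e j))"
    by (rule sum.swap)
  also have "\<dots> = (\<Sum>j=1..DIM('e). b (\<Sum>i\<in>Basis. (L (e j) \<bullet> i) *\<^sub>R i) (e j))"
    by (simp add: sum_left alg)
  finally show ?thesis by (simp add: euclidean_representation)
qed

end

section \<open>Traces of self-adjoint endomorphisms\<close>

text \<open>The algebraic core of the theorem, with \<open>b\<close> the metric and \<open>A\<close> the shape operator at a point. The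
  square completed in the proof vanishes exactly if \<open>A X = \<kappa> X\<close> and \<open>Tr A = 4 \<kappa>\<close>. As \<open>A\<close> is
  self-adjoint, the first condition makes its matrix block diagonal.\<close>

lemma trace_inequality:
  fixes A :: "'e \<Rightarrow> 'e"
  assumes A: "linear A" and X: "b X X = 1" and m: "DIM('e) = Suc m"
    and self_adjoint: "\<And>u v. b (A u) v = b u (A v)"
  defines "\<kappa> \<equiv> b (A X) X"
  shows "Tr A * \<kappa> - b (A X) (A X) \<le> (Tr A)\<^sup>2 / 8 + \<kappa>\<^sup>2"
    and "Tr A * \<kappa> - b (A X) (A X) = (Tr A)\<^sup>2 / 8 + \<kappa>\<^sup>2 \<longleftrightarrow>
      (\<exists>e B \<mu>. orthonormal_basis b e \<and> e (Suc m) = X \<and>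
         (\<forall>i\<in>{1..m}. \<forall>j\<in>{1..m}. B i j = B j i) \<and>
         represented_by A e (block_diag m B \<mu>) \<and> (\<Sum>i=1..m. B i i) = 3 * \<mu>)"
    (is "_ \<longleftrightarrow> ?block")
proof -
  have square: "(Tr A)\<^sup>2 / 8 + \<kappa>\<^sup>2 - (Tr A * \<kappa> - b (A X) (A X))
      = (Tr A - 4 * \<kappa>)\<^sup>2 / 8 + b (A X - \<kappa> *\<^sub>R X) (A X - \<kappa> *\<^sub>R X)"
    unfolding alg using X sym[of X "A X"] by (simp add: \<kappa>_def power2_eq_square field_simps)
  show "Tr A * \<kappa> - b (A X) (A X) \<le> (Tr A)\<^sup>2 / 8 + \<kappa>\<^sup>2"
    using square nonneg[of "A X - \<kappa> *\<^sub>R X"] zero_le_power2[of "Tr A - 4 * \<kappa>"] by linarith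
  have eq: "Tr A * \<kappa> - b (A X) (A X) = (Tr A)\<^sup>2 / 8 + \<kappa>\<^sup>2 \<longleftrightarrow> Tr A = 4 * \<kappa> \<and> A X = \<kappa> *\<^sub>R X"
  proof -
    have "Tr A * \<kappa> - b (A X) (A X) = (Tr A)\<^sup>2 / 8 + \<kappa>\<^sup>2 \<longleftrightarrow>
        (Tr A - 4 * \<kappa>)\<^sup>2 / 8 + b (A X - \<kappa> *\<^sub>R X) (A X - \<kappa> *\<^sub>R X) = 0"
      using square by linarith
    also have "\<dots> \<longleftrightarrow> (Tr A - 4 * \<kappa>)\<^sup>2 / 8 = 0 \<and> b (A X - \<kappa> *\<^sub>R X) (A X - \<kappa> *\<^sub>R X) = 0"
      by (rule add_nonneg_eq_0_iff) (simp_all add: nonneg)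
    finally show ?thesis by (simp add: eq_0_iff)
  qed
  show "Tr A * \<kappa> - b (A X) (A X) = (Tr A)\<^sup>2 / 8 + \<kappa>\<^sup>2 \<longleftrightarrow> ?block"
    unfolding eq
  proof
    assume asm: "Tr A = 4 * \<kappa> \<and> A X = \<kappa> *\<^sub>R X"
    obtain e where e: "orthonormal_basis b e" "e (Suc m) = X"
      using orthonormal_basis_with_last[OF X] m by metis
    define B where "B i j = b (A (e j)) (e i)" for i j
    have symB: "B i j = B j i" for i j
      unfolding B_def self_adjoint[of "e j"] by (rule sym)
    have last: "B (Suc m) j = \<kappa> * b (e j) (e (Suc m))" for j
      using asm by (simp add: B_def self_adjoint e(2) alg)
    have entry: "B i j = block_diag m B \<kappa> i j" if "i \<in> {1..Suc m}" "j \<in> {1..Suc m}" for i j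
    proof -
      have "B (Suc m) j = (if j = Suc m then \<kappa> else 0)" if "j \<in> {1..Suc m}" for j
        unfolding last using e(1) that m by (auto simp: orthonormal_basis_def)
      then show ?thesis
        using that symB[of i "Suc m"] by (cases "i = Suc m"; cases "j = Suc m") (auto simp: block_diag_def)
    qed
    have "represented_by A e (block_diag m B \<kappa>)"
      unfolding represented_by_def m
    proof
      fix j assume j: "j \<in> {1..Suc m}"
      have "A (e j) = (\<Sum>i=1..Suc m. B i j *\<^sub>R e i)"
        using onb_expand[OF e(1), of "A (e j)"] by (simp add: B_def m)
      also have "\<dots> = (\<Sum>i=1..Suc m. block_diag m B \<kappa> i j *\<^sub>R e i)"
        using entry j by (intro sum.cong) auto
      finally show "A (e j) = (\<Sum>i=1..Suc m. block_diag m B \<kappa> i j *\<^sub>R e i)" .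
    qed
    moreover have "(\<Sum>i=1..m. B i i) = 3 * \<kappa>"
    proof -
      have "Tr A = (\<Sum>i=1..m. B i i) + \<kappa>"
        unfolding onb_trace[OF e(1) A] m by (simp add: B_def e(2) \<kappa>_def)
      then show ?thesis using asm by simp
    qed
    ultimately show ?block using e symB by blast
  next
    assume ?block
    then obtain e B \<mu> where e: "orthonormal_basis b e" "e (Suc m) = X"
      and rep: "represented_by A e (block_diag m B \<mu>)" and tr: "(\<Sum>i=1..m. B i i) = 3 * \<mu>"
      by blast
    have entry: "b (A (e j)) (e j) = block_diag m B \<mu> j j" if "j \<in> {1..Suc m}" for j
      using rep that orthonormal_coefficient[OF onb_upto[OF e(1)], of j "\<lambda>i. block_diag m B \<mu> i j"]
      by (simp add: represented_by_def m)
    have "A X = (\<Sum>i=1..Suc m. block_diag m B \<mu> i (Suc m) *\<^sub>R e i)"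
      using rep[unfolded represented_by_def m, rule_format, of "Suc m"] e(2) by simp
    also have "\<dots> = (\<Sum>i=1..m. block_diag m B \<mu> i (Suc m) *\<^sub>R e i) + \<mu> *\<^sub>R X"
      by (simp add: e(2) block_diag_def)
    also have "(\<Sum>i=1..m. block_diag m B \<mu> i (Suc m) *\<^sub>R e i) = 0"
      by (intro sum.neutral) (auto simp: block_diag_def)
    finally have AX: "A X = \<mu> *\<^sub>R X" by simp
    then have "\<kappa> = \<mu>" using X by (simp add: \<kappa>_def alg)
    have "Tr A = (\<Sum>j=1..Suc m. block_diag m B \<mu> j j)"
      unfolding onb_trace[OF e(1) A] m by (intro sum.cong) (simp_all only: entry)
    also have "\<dots> = (\<Sum>j=1..m. B j j) + \<mu>"
      by (simp add: block_diag_def)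
    finally show "Tr A = 4 * \<kappa> \<and> A X = \<kappa> *\<^sub>R X"
      using tr AX \<open>\<kappa> = \<mu>\<close> by simp
  qed
qed

end

section \<open>The Ricci curvature of a real hypersurface\<close>

locale kaehler_hypersurface = kaehler_chart T G + hypersurface T G S F h N
  for T :: "(complex ^ 'n) set" and G
    and S :: "'e::euclidean_space set" and F :: "'e \<Rightarrow> complex ^ 'n" and h and N
begin

text \<open>In each term of the sum over an orthonormal basis the Gauss equation and the form of the ambient
  curvature leave squares of coefficients of \<open>X\<close>, \<open>\<phi>X\<close> and \<open>A X\<close>; by Parseval these add up to \<open>1\<close>,
  \<open>|\<phi>X|\<^sup>2\<close> and \<open>|A X|\<^sup>2\<close>.\<close>

lemma ricci_curvature:
  assumes x: "x \<in> S" and X: "h x X X = 1"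
    and hol: "\<And>u. u \<noteq> 0 \<Longrightarrow> sectional_curvature G (F x) u (Jc u) = 4 * c"
  defines "A \<equiv> shape_operator G F N x" and "\<phi>X \<equiv> tangential_J G F x X"
  shows "Ric h x X = c * (real DIM('e) - 1 + 3 * h x \<phi>X \<phi>X) + Tr A * h x (A X) X - h x (A X) (A X)"
proof -
  interpret hh: inner_prod "h x" by (rule M.inner_prod_at[OF x])
  define e where "e = (SOME e. orthonormal_basis (h x) e)"
  have e: "orthonormal_basis (h x) e"
  proof -
    obtain e' where "orthonormal_basis (h x) e'"
      by (rule hh.orthonormal_basis_with_last[OF X])
    then show ?thesis unfolding e_def by (rule someI[of "orthonormal_basis (h x)"])
  qed
  note A_form = shape_operator_form[OF x, folded A_def]
  have A: "linear A" unfolding A_def by (rule linear_shape_operator[OF x])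
  have \<phi>X: "h x \<phi>X w = G (F x) (Jc (dd F x X)) (dd F x w)" for w
    unfolding \<phi>X_def tangential_J_def by (rule tangential_part[OF x])
  have term_eq: "h x (curvature h x (e j) X X) (e j)
      = c * (h x (e j) (e j) - (h x X (e j))\<^sup>2 + 3 * (h x \<phi>X (e j))\<^sup>2)
        + h x (A X) X * h x (A (e j)) (e j) - (h x (A X) (e j))\<^sup>2" for j
  proof -
    have "G (F x) (curvature G (F x) (dF (e j) x) (dF X x) (dF X x)) (dF (e j) x)
      = 4 * c / 4 * (h x (e j) (e j) * h x X X - (h x (e j) X)\<^sup>2
          + 3 * (G (F x) (dF (e j) x) (Jc (dF X x)))\<^sup>2)"
      unfolding induced[OF x] by (rule constant_holomorphic_curvature_tensor[OF F_in[OF x] hol])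
    moreover have "G (F x) (dF (e j) x) (Jc (dF X x)) = h x \<phi>X (e j)"
      unfolding \<phi>X by (rule inner_prod.sym[OF inner_prod_at[OF F_in[OF x]]])
    moreover have "second_form x (e j) X = h x (A X) (e j)"
      unfolding A_form by (rule second_form_sym[OF x])
    moreover have "h x (e j) X = h x X (e j)" by (rule hh.sym)
    ultimately show ?thesis
      using gauss_equation[OF x, of "e j" X X "e j"] X
      by (simp add: A_form[symmetric] power2_eq_square)
  qed
  have "(\<Sum>j=1..DIM('e). h x (e j) (e j)) = (\<Sum>j=1..DIM('e). 1)"
    using e by (intro sum.cong) (auto simp: orthonormal_basis_def)
  then have 1: "(\<Sum>j=1..DIM('e). h x (e j) (e j)) = real DIM('e)" by simp
  have 2: "(\<Sum>j=1..DIM('e). (h x v (e j))\<^sup>2) = h x v v" for v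
    by (simp add: hh.onb_parseval[OF e, of v v] power2_eq_square)
  have "Ric h x X = (\<Sum>j=1..DIM('e). h x (curvature h x (e j) X X) (e j))"
    unfolding Ric_def e_def by (simp add: Let_def)
  also have "\<dots> = c * ((\<Sum>j=1..DIM('e). h x (e j) (e j)) - (\<Sum>j=1..DIM('e). (h x X (e j))\<^sup>2)
        + 3 * (\<Sum>j=1..DIM('e). (h x \<phi>X (e j))\<^sup>2))
      + h x (A X) X * (\<Sum>j=1..DIM('e). h x (A (e j)) (e j)) - (\<Sum>j=1..DIM('e). (h x (A X) (e j))\<^sup>2)"
    unfolding term_eq by (simp only: sum_subtractf sum.distrib flip: sum_distrib_left)
  also have "\<dots> = c * (real DIM('e) - 1 + 3 * h x \<phi>X \<phi>X) + Tr A * h x (A X) X - h x (A X) (A X)"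
    unfolding 1 2 hh.onb_trace[OF e A, symmetric] X by simp
  finally show ?thesis .
qed

lemma norm_mean_curvature_vector:
  assumes x: "x \<in> S"
  shows "G (F x) (mean_curvature_vector G F N x) (mean_curvature_vector G F N x)
    = (Tr (shape_operator G F N x) / real DIM('e))\<^sup>2"
  using unit_N[OF x] bilin[OF F_in[OF x]]
  by (simp add: mean_curvature_vector_def bilinear_lmul bilinear_rmul power2_eq_square)

end

theorem lemma2p2:
  fixes \<A> :: "('a::{t2_space, second_countable_topology}, complex ^ 'n) chart set"
    and g :: "('a, complex ^ 'n) chart \<Rightarrow> (complex ^ 'n) metric"
    and \<B> :: "('m::{t2_space, second_countable_topology}, 'e::euclidean_space) chart set"
    and h :: "('m, 'e) chart \<Rightarrow> 'e metric"
    and f :: "'m \<Rightarrow> 'a"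
    and c :: real
    and \<phi> :: "('m, 'e) chart"
    and \<psi> :: "('a, complex ^ 'n) chart"
    and N :: "'m \<Rightarrow> complex ^ 'n"
    and W :: "'m set"
    and p :: 'm
    and X :: 'e
  assumes "complex_space_form \<A> g (4 * c)" and "c \<noteq> 0"
    and "real_hypersurface \<A> g \<B> h f"
    and "\<phi> \<in> \<B>" and "\<psi> \<in> \<A>"
    and "open W" and "p \<in> W" and "W \<subseteq> fst \<phi> \<inter> f -` fst \<psi>"
    and "unit_normal_on (g \<psi>) (in_charts \<phi> \<psi> f) (snd \<phi> ` W) (N \<circ> chart_inv \<phi>)"
    and "h \<phi> (snd \<phi> p) X X = 1"
  shows "let n = CARD('n);
             x = snd \<phi> p;
             F = in_charts \<phi> \<psi> f;
             A = shape_operator (g \<psi>) F (N \<circ> chart_inv \<phi>) x;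
             H = mean_curvature_vector (g \<psi>) F (N \<circ> chart_inv \<phi>) x;
             \<kappa>\<^sub>X = h \<phi> x (A X) X;
             \<phi>X = tangential_J (g \<psi>) F x X;
             lhs = Ric (h \<phi>) x X;
             rhs = (2 * real n - 1)\<^sup>2 / 8 * g \<psi> (F x) H H + \<kappa>\<^sub>X\<^sup>2
                   + c * (2 * real n - 2 + 3 * h \<phi> x \<phi>X \<phi>X)
         in lhs \<le> rhs \<and>
            (lhs = rhs \<longleftrightarrow>
              (\<exists>e B \<mu>. orthonormal_basis (h \<phi> x) e \<and> e (2 * n - 1) = X \<and>
                 (\<forall>i\<in>{1..2 * n - 2}. \<forall>j\<in>{1..2 * n - 2}. B i j = B j i) \<and>
                 represented_by A e (block_diag (2 * n - 2) B \<mu>) \<and>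
                 (\<Sum>i=1..2 * n - 2. B i i) = 3 * \<mu>))"
proof -
  let ?T = "snd \<psi> ` fst \<psi>" and ?S = "snd \<phi> ` W" and ?F = "in_charts \<phi> \<psi> f"
    and ?N = "N \<circ> chart_inv \<phi>" and ?x = "snd \<phi> p"
  have kaehler: "kaehler_manifold \<A> g"
    and hol: "\<And>x u. x \<in> ?T \<Longrightarrow> u \<noteq> 0 \<Longrightarrow> sectional_curvature (g \<psi>) x u (Jc u) = 4 * c"
    using assms(1,5) unfolding complex_space_form_def by auto
  have riemA: "riemannian_manifold \<A> g"
    and hermitian: "\<And>x u v. x \<in> ?T \<Longrightarrow> g \<psi> x (Jc u) (Jc v) = g \<psi> x u v"
    and parallel: "\<And>x u v. x \<in> ?T \<Longrightarrow>
      cov_deriv (g \<psi>) (\<lambda>_. Jc v) x u = Jc (cov_deriv (g \<psi>) (\<lambda>_. v) x u)"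
    using kaehler assms(5) unfolding kaehler_manifold_def by auto
  have riemB: "riemannian_manifold \<B> h" and dim: "DIM('e) + 1 = 2 * CARD('n)"
    and immersion: "smooth_on ?F (snd \<phi> ` (fst \<phi> \<inter> f -` fst \<psi>))"
      "\<And>x u v. x \<in> snd \<phi> ` (fst \<phi> \<inter> f -` fst \<psi>) \<Longrightarrow> h \<phi> x u v = g \<psi> (?F x) (dd ?F x u) (dd ?F x v)"
    using assms(3-5) unfolding real_hypersurface_def by auto
  have S_sub: "?S \<subseteq> snd \<phi> ` (fst \<phi> \<inter> f -` fst \<psi>)" "?S \<subseteq> snd \<phi> ` fst \<phi>"
    using assms(8) by auto
  have metric_h: "\<And>x. x \<in> snd \<phi> ` fst \<phi> \<Longrightarrow> inner_product (h \<phi> x)"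
    "\<And>u v. smooth_on (\<lambda>x. h \<phi> x u v) (snd \<phi> ` fst \<phi>)"
    using riemB assms(4) unfolding riemannian_manifold_def by auto
  have homeo: "homeomorphism (fst \<phi>) (snd \<phi> ` fst \<phi>) (snd \<phi>) (chart_inv \<phi>)"
    and open_dom: "open (snd \<phi> ` fst \<phi>)"
    using riemB assms(4) unfolding riemannian_manifold_def smooth_atlas_def by auto
  have "openin (top_of_set (snd \<phi> ` fst \<phi>)) ?S"
    using homeomorphism_imp_open_map[OF homeo, of W] assms(6,8)
    by (meson inf.boundedE open_openin_trans open_subset openin_open_eq subset_trans)
  then have open_S: "open ?S"
    using open_dom openin_open_trans by blast
  have F_in: "?F y \<in> ?T" if y: "y \<in> ?S" for y
  proof -
    obtain q where q: "q \<in> W" "y = snd \<phi> q" using y by blast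
    then have "chart_inv \<phi> y = q"
      using homeo assms(8) unfolding homeomorphism_def by auto
    then show ?thesis using q assms(8) by (auto simp: in_charts_def)
  qed
  (* From here on only the coordinate domains of the two charts matter; the hypersurface is
     restricted to the domain of its unit normal. *)
  interpret kaehler_hypersurface ?T "g \<psi>" ?S ?F "h \<phi>" ?N
  proof unfold_locales
    show "open ?T" "\<And>x. x \<in> ?T \<Longrightarrow> inner_product (g \<psi> x)"
      "\<And>u v. smooth_on (\<lambda>x. g \<psi> x u v) ?T"
      using riemA assms(5) unfolding riemannian_manifold_def smooth_atlas_def by auto
    show "christoffel (g \<psi>) x u (Jc v) = Jc (christoffel (g \<psi>) x u v)" if "x \<in> ?T" for x u v
      using parallel[OF that, of v u] by (simp add: cov_deriv_def)
    show "inner_product (h \<phi> x)" if "x \<in> ?S" for x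
      using metric_h(1) S_sub(2) that by blast
    show "smooth_on (\<lambda>x. h \<phi> x u v) ?S" for u v
      by (rule smooth_on_subset[OF metric_h(2) S_sub(2)])
    show "smooth_on ?F ?S" by (rule smooth_on_subset[OF immersion(1) S_sub(1)])
    show "h \<phi> x u v = g \<psi> (?F x) (dd ?F x u) (dd ?F x v)" if "x \<in> ?S" for x u v
      using immersion(2) S_sub(1) that by blast
    show "DIM('e) + 1 = DIM(complex ^ 'n)" using dim by simp
    show "smooth_on ?N ?S" "\<And>x. x \<in> ?S \<Longrightarrow> g \<psi> (?F x) (?N x) (?N x) = 1"
      "\<And>x u. x \<in> ?S \<Longrightarrow> g \<psi> (?F x) (?N x) (dd ?F x u) = 0"
      using assms(9) unfolding unit_normal_on_def by auto
  qed (use open_S F_in hermitian in auto)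
  have x: "?x \<in> ?S" using assms(7) by blast
  interpret hh: inner_prod "h \<phi> ?x" by (rule M.inner_prod_at[OF x])
  have m: "DIM('e) = Suc (2 * CARD('n) - 2)" "2 * CARD('n) - 1 = Suc (2 * CARD('n) - 2)"
    using dim DIM_positive[where 'a='e] by linarith+
  have real_dim: "real DIM('e) = 2 * real CARD('n) - 1"
    using dim by (simp add: of_nat_eq_iff[where 'a=real, symmetric])
  let ?A = "shape_operator (g \<psi>) ?F ?N ?x" and ?\<phi>X = "tangential_J (g \<psi>) ?F ?x X"
    and ?H = "mean_curvature_vector (g \<psi>) ?F ?N ?x"
  let ?K = "c * (2 * real CARD('n) - 2 + 3 * h \<phi> ?x ?\<phi>X ?\<phi>X)"
  have "Ric (h \<phi>) ?x X = c * (real DIM('e) - 1 + 3 * h \<phi> ?x ?\<phi>X ?\<phi>X)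
      + Tr ?A * h \<phi> ?x (?A X) X - h \<phi> ?x (?A X) (?A X)"
    by (rule ricci_curvature[OF x assms(10) hol[OF F_in[OF x]]])
  then have ricci: "Ric (h \<phi>) ?x X = (Tr ?A * h \<phi> ?x (?A X) X - h \<phi> ?x (?A X) (?A X)) + ?K"
    unfolding real_dim by simp
  have "(2 * real CARD('n) - 1)\<^sup>2 / 8 * g \<psi> (?F ?x) ?H ?H = (Tr ?A)\<^sup>2 / 8"
    unfolding norm_mean_curvature_vector[OF x] by (simp add: power_divide flip: real_dim)
  then have rhs: "(2 * real CARD('n) - 1)\<^sup>2 / 8 * g \<psi> (?F ?x) ?H ?H + (h \<phi> ?x (?A X) X)\<^sup>2 + ?K
      = ((Tr ?A)\<^sup>2 / 8 + (h \<phi> ?x (?A X) X)\<^sup>2) + ?K"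
    by simp
  note ineq = hh.trace_inequality[OF linear_shape_operator[OF x] assms(10) m(1) shape_operator_sym[OF x]]
  show ?thesis
    unfolding Let_def rhs ricci m(2) ineq(2)[symmetric] using ineq(1) by simp
qed

end
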